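(* Let $\mu_\omega$, $\omega\in\Omega$, be the random Moran measures described in the context, and assume that there exists $A_0>0$ such that $\mathbb{E}(e^{\lambda Z_1})<\infty$ for all $|\lambda|\le A_0$. Then there is a set $\Gamma\subseteq\Omega$ of full $\mathbb{P}$-measure with the following properties: (i) If there exists $A>0$ such that $\mathbb{E}(e^{\lambda X_1})<\infty$ for all $|\lambda|\le A$, then $\underline{\dim}_\Phi\,\mu_\omega=\mathbb{E}(X_1)/\mathbb{E}(Z_1)$ for all large dimension functions $\Phi$ and for all $\omega\in\Gamma$. (ii) If there exists $A>0$ such that $\mathbb{E}(e^{\lambda Y_1})<\infty$ for all $|\lambda|\le A$, then $\overline{\dim}_\Phi\,\mu_\omega=\mathbb{E}(Y_1)/\mathbb{E}(Z_1)$ for all large dimension functions $\Phi$ and for all $\omega\in\Gamma$.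
   Context: **Random Moran sets and measures.** Fix a compact set $I_0\subseteq\mathbb{R}^D$ with diameter $1$ and non-empty interior, and fix $0<\tau<1$. For a set $I$ and $r>0$, a subset $J\subseteq I$ is an $r$-similarity of $I$ if $J=S(I)$ for some similarity $S$ with $\mathrm{diam}(J)=r\,\mathrm{diam}(I)$. A collection $J_1,\dots,J_t$ of $r$-similarities of $I$ is $\tau$-separated if $d(J_i,J_j)\ge\tau\, r\,\mathrm{diam}(I)$ for all $i\ne j$. For each $t\in\mathbb{N}$ fix $\rho_t\in(0,1/2]$ such that for every $0<r\le\rho_t$ there is a $\tau$-separated collection of $t$ $r$-similarities of $I_0$. For $t\ge2$ let $\mathcal{S}_t=\{(x_1,\dots,x_t)\in\mathbb{R}^t: x_i>0,\ \sum_i x_i=1\}$, $\Omega_t=(0,\rho_t]\times\mathcal{S}_t$, and $\Omega_0=\bigcup_{t\ge2}\Omega_t$ (disjoint union). Let $\pi$ be a Borel probability measure on $\Omega_0$ and let $\mathbb{P}$ be the product measure induced by $\pi$ on $\Omega=\Omega_0^{\mathbb{N}}$. For $\omega\in\Omega$, the $n$-th coordinate is an element of some $\Omega_t$ and is written $(r_n,p_n^{(1)},\dots,p_n^{(t)})$; put $T_n=t$. Thus $(T_n,r_n,p_n)$, $n\ge1$, are iid. Given $\omega$, start with $I_0$ as the only Moran set of step $0$; from each Moran set $I$ of step $n$ select $T_{n+1}(\omega)$ subsets (the children of $I$) that are $r_{n+1}(\omega)$-similarities of $I$ and are $\tau$-separated (any such selection). All the children so obtained are the Moran sets of step $n+1$;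 they have diameter $r_1\cdots r_{n+1}$. The random Moran set $E(\omega)$ is the intersection over $n$ of the union of all step $n$ Moran sets. The random Moran measure $\mu_\omega$ is the Borel probability measure supported on $E(\omega)$ with $\mu_\omega(I_0)=1$ and $\mu_\omega(I^{(j)})=\mu_\omega(I)\,p_{n+1}^{(j)}$ whenever $I^{(1)},\dots,I^{(T_{n+1})}$ are the (labelled) children of the step $n$ Moran set $I$. Put $M_n=\max_j p_n^{(j)}$, $m_n=\min_j p_n^{(j)}$, $X_n=-\log M_n$, $Y_n=-\log m_n$, $Z_n=-\log r_n$. **$\Phi$-dimensions.** A dimension function is a map $\Phi:(0,1)\to[0,\infty)$ such that $x^{1+\Phi(x)}$ decreases to $0$ as $x$ decreases to $0$. For a Borel probability measure $\mu$, with $B(x,R)$ the open ball, $\overline{\dim}_\Phi\mu$ is the infimum of all $d$ for which there are $C_1,C_2>0$ such that for all $0<r<R^{1+\Phi(R)}\le R\le C_1$ and all $x\in\mathrm{supp}\,\mu$, $\frac{\mu(B(x,R))}{\mu(B(x,r))}\le C_2\left(\frac Rr\right)^d$; and $\underline{\dim}_\Phi\mu$ is the supremum of all $d$ for which there are $C_1,C_2>0$ such that for all $0<r<R^{1+\Phi(R)}\le R\le C_1$ and all $x\in\mathrm{supp}\,\mu$, $\frac{\mu(B(x,R))}{\mu(B(x,r))}\ge C_2\left(\frac Rr\right)^d$. A dimension function $\Phi$ is *large* if there are a function $A(x)$ with $A(x)\to\infty$ as $x\to0^+$ and $\delta>0$ such that $\Phi(x)\ge A(x)\,\frac{\log|\log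 x|}{|\log x|}$ for all $0<x<\delta$. *)

theory Defs
  imports "HOL-Probability.Probability"
begin

definition similarity :: "('a::metric_space \<Rightarrow> 'a) \<Rightarrow> bool" where
  "similarity S \<longleftrightarrow> (\<exists>c>0. \<forall>x y. dist (S x) (S y) = c * dist x y)"

definition is_r_similarity :: "real \<Rightarrow> 'a::metric_space set \<Rightarrow> 'a set \<Rightarrow> bool" where
  "is_r_similarity r I J \<longleftrightarrow>
     J \<subseteq> I \<and> (\<exists>S. similarity S \<and> J = S ` I) \<and> diameter J = r * diameter I"

definition separated_similarities ::
    "real \<Rightarrow> nat \<Rightarrow> real \<Rightarrow> 'a::metric_space set \<Rightarrow> (nat \<Rightarrow> 'a set) \<Rightarrow> bool" where
  "separated_similarities \<tau> t r I J \<longleftrightarrow>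
     (\<forall>i<t. is_r_similarity r I (J i)) \<and>
     (\<forall>i<t. \<forall>j<t. i \<noteq> j \<longrightarrow> \<tau> * r * diameter I \<le> setdist (J i) (J j))"

text \<open>
  A point of the disjoint union of the sets \<open>(0, \<rho> t] \<times> \<S> t\<close>, for \<open>t \<ge> 2\<close>, is encoded as
  a triple \<open>(t, r, p)\<close>. The weights are \<open>p 0, \<dots>, p (t - 1)\<close>, and \<open>p\<close> is padded with zeros.
  Since \<open>nat\<close> is discrete and functions carry the product topology, the subspace
  topology of \<open>Omega0 \<rho>\<close> is exactly the disjoint union topology.
\<close>

type_synonym step = "nat \<times> real \<times> (nat \<Rightarrow> real)"

definition num_children :: "step \<Rightarrow> nat" where
  "num_children x = fst x"

definition ratio :: "step \<Rightarrow> real" where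
  "ratio x = fst (snd x)"

definition weight :: "step \<Rightarrow> nat \<Rightarrow> real" where
  "weight x = snd (snd x)"

definition Omega0 :: "(nat \<Rightarrow> real) \<Rightarrow> step set" where
  "Omega0 \<rho> = {x. 2 \<le> num_children x \<and> 0 < ratio x \<and> ratio x \<le> \<rho> (num_children x) \<and>
     (\<forall>j<num_children x. 0 < weight x j) \<and> (\<Sum>j<num_children x. weight x j) = 1 \<and>
     (\<forall>j\<ge>num_children x. weight x j = 0)}"

definition borel_prob_on_Omega0 :: "(nat \<Rightarrow> real) \<Rightarrow> step measure \<Rightarrow> bool" where
  "borel_prob_on_Omega0 \<rho> \<pi> \<longleftrightarrow>
     prob_space \<pi> \<and> sets \<pi> = sets (restrict_space borel (Omega0 \<rho>))"

text \<open>
  Coordinates of a sequence \<open>\<omega>\<close> are numbered from \<open>0\<close>, so \<open>\<omega> n\<close> governs the passage from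
  the Moran sets of step \<open>n\<close> to those of step \<open>n + 1\<close>.
\<close>

definition seq_prob :: "step measure \<Rightarrow> (nat \<Rightarrow> step) measure" where
  "seq_prob \<pi> = PiM UNIV (\<lambda>_. \<pi>)"

definition X_val :: "step \<Rightarrow> real" where
  "X_val x = - ln (Max (weight x ` {..<num_children x}))"

definition Y_val :: "step \<Rightarrow> real" where
  "Y_val x = - ln (Min (weight x ` {..<num_children x}))"

definition Z_val :: "step \<Rightarrow> real" where
  "Z_val x = - ln (ratio x)"

definition finite_exp_moments :: "'b measure \<Rightarrow> ('b \<Rightarrow> real) \<Rightarrow> bool" where
  "finite_exp_moments P W \<longleftrightarrow>
     (\<exists>A>0. \<forall>s. \<bar>s\<bar> \<le> A \<longrightarrow> (\<integral>\<^sup>+ \<omega>. ennreal (exp (s * W \<omega>)) \<partial>P) < \<infinity>)"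

text \<open>
  Moran sets of step \<open>n\<close> are labelled by words of length \<open>n\<close>. The root is the empty
  word, and the children of \<open>J w\<close> are the sets \<open>J (w @ [j])\<close>.
\<close>

definition moran_words :: "(nat \<Rightarrow> step) \<Rightarrow> nat \<Rightarrow> nat list set" where
  "moran_words \<omega> n = {w. length w = n \<and> (\<forall>k<n. w ! k < num_children (\<omega> k))}"

definition moran_family ::
    "real \<Rightarrow> 'a::metric_space set \<Rightarrow> (nat \<Rightarrow> step) \<Rightarrow> (nat list \<Rightarrow> 'a set) \<Rightarrow> bool" where
  "moran_family \<tau> I0 \<omega> J \<longleftrightarrow>
     J [] = I0 \<and>
     (\<forall>n. \<forall>w\<in>moran_words \<omega> n.
        separated_similarities \<tau> (num_children (\<omega> n)) (ratio (\<omega> n)) (J w) (\<lambda>j. J (w @ [j])))"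

definition moran_set :: "(nat \<Rightarrow> step) \<Rightarrow> (nat list \<Rightarrow> 'a set) \<Rightarrow> 'a set" where
  "moran_set \<omega> J = (\<Inter>n. \<Union>w\<in>moran_words \<omega> n. J w)"

definition is_moran_measure ::
    "(nat \<Rightarrow> step) \<Rightarrow> (nat list \<Rightarrow> 'a::metric_space set) \<Rightarrow> 'a measure \<Rightarrow> bool" where
  "is_moran_measure \<omega> J M \<longleftrightarrow>
     prob_space M \<and> sets M = sets borel \<and>
     (AE x in M. x \<in> moran_set \<omega> J) \<and>
     measure M (J []) = 1 \<and>
     (\<forall>n. \<forall>w\<in>moran_words \<omega> n. \<forall>j<num_children (\<omega> n).
        measure M (J (w @ [j])) = measure M (J w) * weight (\<omega> n) j)"

text \<open>Only the values of a dimension function on \<open>(0, 1)\<close> are meaningful.\<close>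

definition dimension_function :: "(real \<Rightarrow> real) \<Rightarrow> bool" where
  "dimension_function \<Phi> \<longleftrightarrow>
     (\<forall>x\<in>{0<..<1}. 0 \<le> \<Phi> x) \<and>
     mono_on {0<..<1} (\<lambda>x. x powr (1 + \<Phi> x)) \<and>
     ((\<lambda>x. x powr (1 + \<Phi> x)) \<longlongrightarrow> 0) (at_right 0)"

definition large :: "(real \<Rightarrow> real) \<Rightarrow> bool" where
  "large \<Phi> \<longleftrightarrow>
     (\<exists>A \<delta>. filterlim A at_top (at_right 0) \<and> 0 < \<delta> \<and> \<delta> \<le> 1 \<and>
        (\<forall>x. 0 < x \<and> x < \<delta> \<longrightarrow> A x * (ln \<bar>ln x\<bar> / \<bar>ln x\<bar>) \<le> \<Phi> x))"

definition measure_support :: "'a::metric_space measure \<Rightarrow> 'a set" where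
  "measure_support M = {x. \<forall>r>0. 0 < emeasure M (ball x r)}"

text \<open>
  The bound \<open>C1 < 1\<close> keeps \<open>R\<close> in the domain \<open>(0, 1)\<close> of \<open>\<Phi>\<close>. It is harmless, as a constant
  \<open>C1\<close> can always be decreased. The infimum and supremum are extended real, so that the
  infimum of the empty set is infinite.
\<close>

definition upper_Phi_dim :: "(real \<Rightarrow> real) \<Rightarrow> 'a::metric_space measure \<Rightarrow> ereal" where
  "upper_Phi_dim \<Phi> M = Inf {ereal d | d. \<exists>C1 C2. 0 < C1 \<and> C1 < 1 \<and> 0 < C2 \<and>
     (\<forall>r R. 0 < r \<and> r < R powr (1 + \<Phi> R) \<and> R powr (1 + \<Phi> R) \<le> R \<and> 0 < R \<and> R \<le> C1 \<longrightarrow>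
        (\<forall>x\<in>measure_support M.
           measure M (ball x R) / measure M (ball x r) \<le> C2 * (R / r) powr d))}"

definition lower_Phi_dim :: "(real \<Rightarrow> real) \<Rightarrow> 'a::metric_space measure \<Rightarrow> ereal" where
  "lower_Phi_dim \<Phi> M = Sup {ereal d | d. \<exists>C1 C2. 0 < C1 \<and> C1 < 1 \<and> 0 < C2 \<and>
     (\<forall>r R. 0 < r \<and> r < R powr (1 + \<Phi> R) \<and> R powr (1 + \<Phi> R) \<le> R \<and> 0 < R \<and> R \<le> C1 \<longrightarrow>
        (\<forall>x\<in>measure_support M.
           C2 * (R / r) powr d \<le> measure M (ball x R) / measure M (ball x r)))}"

end

theory Submission
  imports Defs
begin

text \<open>
  By the separation condition, a ball of radius \<open>R\<close> around a point of the support is sandwiched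
  between Moran sets whose generations \<open>n\<close> satisfy \<open>R \<approx> r\<^sub>1 \<cdots> r\<^sub>n\<close> up to the constant
  \<open>\<tau>\<close>. Hence the logarithms of \<open>R / r\<close> and of the ratio of the measures of the balls are sums over a
  window of generations \<open>n < k \<le> m\<close>: of the \<open>Z k\<close> for the former, and between the sums of the
  \<open>X k\<close> and of the \<open>Y k\<close> for the latter. Chernoff bounds and Borel--Cantelli show that almost
  surely all windows \<open>(n, m]\<close> of length at least \<open>K ln n\<close> have averages close to the expectation,
  and a large \<open>\<Phi>\<close> only admits such windows. Sharpness comes from the points
  that always lie in the heaviest (respectively lightest) child, with \<open>R\<close> fixed and \<open>r \<rightarrow> 0\<close>.
\<close>

section \<open>Large deviations over windows\<close>

text \<open>The set \<open>\<Gamma>\<close> must serve all large \<open>\<Phi>\<close> at once, an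
  uncountable family, so no event may depend on \<open>\<Phi>\<close>. This is why
  \<open>window_law\<close> mentions no scales: every \<open>\<epsilon>\<close> comes with some
  factor \<open>K\<close>, and since \<open>A x\<close> tends to infinity a large
  \<open>\<Phi>\<close> eventually beats each such \<open>K\<close>. The rest is deterministic, for
  one \<open>\<omega>\<close> and an arbitrary choice of Moran sets. The length
  \<open>K ln n\<close> is what Borel-Cantelli can pay for: infinitely many windows start at
  \<open>n\<close>, one of length \<open>L\<close> is bad with probability at most
  \<open>q ^ L\<close>, and for large \<open>K\<close> half of this exponent yields
  \<open>1 / n\<^sup>2\<close> while the other half is summed over \<open>L\<close>. The threshold
  \<open>ln |ln x| / |ln x|\<close> is the same length seen from the scales: ratios are at most
  \<open>1/2\<close>, so the generation \<open>n\<close> of a ball of radius \<open>R\<close> is at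
  most of order \<open>|ln R|\<close>, and \<open>r < R powr (1 + \<Phi> R)\<close> makes
  \<open>ln (R / r)\<close> exceed \<open>\<Phi> R * |ln R|\<close>, hence a large multiple of
  \<open>ln n\<close>.\<close>

definition window_law :: "(nat \<Rightarrow> real) \<Rightarrow> real \<Rightarrow> bool" where
  "window_law W e \<longleftrightarrow>
     (\<forall>\<epsilon>>0. \<exists>K N. \<forall>n\<ge>N. \<forall>m. real n + K * ln (real n) \<le> real m \<longrightarrow>
        \<bar>(\<Sum>k=n..<m. W k) - (real m - real n) * e\<bar> \<le> \<epsilon> * (real m - real n))"

text \<open>\<open>1 - x \<le> exp (- x)\<close> times \<open>exp x\<close> gives
  \<open>exp x \<le> 1 + x * exp x\<close>; the remainder \<open>x * (exp x - 1)\<close> is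
  quadratic for either sign of \<open>x\<close>.\<close>

lemma exp_le_quadratic: "exp x \<le> 1 + x + x\<^sup>2 * exp \<bar>x\<bar>" for x :: real
proof -
  have 1: "exp x - 1 \<le> x * exp x"
    using mult_left_mono[OF exp_ge_add_one_self[of "-x"], of "exp x"]
    by (simp add: exp_minus_inverse algebra_simps)
  have "x * (exp x - 1) \<le> x\<^sup>2 * exp \<bar>x\<bar>"
  proof (cases "x \<ge> 0")
    case True
    then show ?thesis
      using mult_left_mono[OF 1 True] by (simp add: power2_eq_square algebra_simps)
  next
    case False
    have "x * (exp x - 1) \<le> x * x"
      using exp_ge_add_one_self[of x] False by (intro mult_left_mono_neg) linarith+
    also have "\<dots> \<le> x\<^sup>2 * exp \<bar>x\<bar>"
      by (simp add: power2_eq_square mult_le_cancel_left1)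
    finally show ?thesis .
  qed
  then show ?thesis using 1 by (simp add: algebra_simps)
qed

text \<open>The moment generating function has the negative slope \<open>expectation V\<close> at
  \<open>0\<close>, so it drops below its value \<open>1\<close> there for small
  \<open>s > 0\<close>.\<close>

lemma (in prob_space) exp_moment_less_1:
  fixes V :: "'a \<Rightarrow> real"
  assumes [measurable]: "V \<in> borel_measurable M" and "integrable M V"
    and A: "A > 0" "integrable M (\<lambda>x. exp (A * \<bar>V x\<bar>))" and neg: "expectation V < 0"
  shows "\<exists>s>0. integrable M (\<lambda>x. exp (s * V x)) \<and> expectation (\<lambda>x. exp (s * V x)) < 1"
proof -
  \<comment> \<open>\<open>C\<close> controls the quadratic term for all
    \<open>s \<le> A / 2\<close>; the \<open>8\<close> comes from
    \<open>u\<^sup>2 / 2 \<le> exp u\<close> at \<open>u = A / 2 * |V x|\<close>.\<close>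
  define C where "C = (8 / A\<^sup>2) * expectation (\<lambda>x. exp (A * \<bar>V x\<bar>))"
  have C0: "C \<ge> 0" unfolding C_def by (intro mult_nonneg_nonneg integral_nonneg) auto
  \<comment> \<open>Half of the exponent \<open>A\<close> absorbs \<open>(V x)\<^sup>2\<close>, the
    other half \<open>exp (s * |V x|)\<close>. The second bound keeps the quadratic term at most
    half as large as the linear one; \<open>C + 1\<close> excludes a zero denominator.\<close>
  define s where "s = min (A / 2) (- expectation V / (2 * (C + 1)))"
  have s0: "s > 0" using A neg C0 by (auto simp: s_def intro!: divide_neg_pos)
  have sA: "s \<le> A / 2" unfolding s_def by (rule min.cobounded1)
  have sC: "s * C < - expectation V"
  proof -
    have "s * C \<le> (- expectation V / (2 * (C + 1))) * (C + 1)"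
      using C0 s0 by (intro mult_mono) (auto simp: s_def)
    also have "\<dots> = - expectation V / 2" using C0 by (simp add: field_simps)
    finally show ?thesis using neg by simp
  qed
  have int: "integrable M (\<lambda>x. exp (s * V x))"
  proof (rule Bochner_Integration.integrable_bound[OF A(2)])
    show "AE x in M. norm (exp (s * V x)) \<le> norm (exp (A * \<bar>V x\<bar>))"
    proof (rule AE_I2)
      fix x
      have "s * V x \<le> s * \<bar>V x\<bar>" using s0 by (intro mult_left_mono) auto
      also have "\<dots> \<le> A * \<bar>V x\<bar>" using sA A by (intro mult_right_mono) auto
      finally show "norm (exp (s * V x)) \<le> norm (exp (A * \<bar>V x\<bar>))" by simp
    qed
  qed measurable
  have bound: "exp (s * V x) \<le> 1 + s * V x + s\<^sup>2 * ((8 / A\<^sup>2) * exp (A * \<bar>V x\<bar>))" for x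
  proof -
    define u where "u = A / 2 * \<bar>V x\<bar>"
    have u0: "u \<ge> 0" using A by (simp add: u_def)
    have "u\<^sup>2 / 2 \<le> exp u"
      using exp_lower_Taylor_quadratic[OF u0] u0 by linarith
    then have "(V x)\<^sup>2 \<le> 8 / A\<^sup>2 * exp u"
      using A by (simp add: u_def field_simps power_mult_distrib)
    moreover have "exp (s * \<bar>V x\<bar>) \<le> exp u"
      unfolding u_def using mult_right_mono[OF sA, of "\<bar>V x\<bar>"] by simp
    ultimately have "(V x)\<^sup>2 * exp (s * \<bar>V x\<bar>) \<le> 8 / A\<^sup>2 * exp u * exp u"
      using A by (intro mult_mono) auto
    also have "\<dots> = 8 / A\<^sup>2 * exp (A * \<bar>V x\<bar>)"
      by (simp add: u_def flip: exp_add)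
    finally have *: "(V x)\<^sup>2 * exp (s * \<bar>V x\<bar>) \<le> 8 / A\<^sup>2 * exp (A * \<bar>V x\<bar>)" .
    have "exp (s * V x) \<le> 1 + s * V x + (s * V x)\<^sup>2 * exp \<bar>s * V x\<bar>"
      by (rule exp_le_quadratic)
    also have "\<dots> = 1 + s * V x + s\<^sup>2 * ((V x)\<^sup>2 * exp (s * \<bar>V x\<bar>))"
      using s0 by (simp add: abs_mult power_mult_distrib)
    also have "\<dots> \<le> 1 + s * V x + s\<^sup>2 * (8 / A\<^sup>2 * exp (A * \<bar>V x\<bar>))"
      using * by (intro add_left_mono mult_left_mono) auto
    finally show ?thesis .
  qed
  have "expectation (\<lambda>x. exp (s * V x)) \<le>
      expectation (\<lambda>x. 1 + s * V x + s\<^sup>2 * ((8 / A\<^sup>2) * exp (A * \<bar>V x\<bar>)))"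
    using int bound assms by (intro integral_mono) auto
  also have "\<dots> = 1 + s * expectation V + s\<^sup>2 * C"
    using assms by (simp add: C_def prob_space)
  also have "\<dots> = 1 + s * (expectation V + s * C)" by (simp add: power2_eq_square algebra_simps)
  also have "\<dots> < 1" using sC s0 by (simp add: mult_pos_neg)
  finally show ?thesis using int s0 by blast
qed

text \<open>The joint law of all coordinates is the law of the identity map, which is the product
  measure itself.\<close>

lemma indep_vars_coordinates:
  assumes "prob_space \<pi>"
  shows "prob_space.indep_vars (PiM (UNIV :: 'i set) (\<lambda>_. \<pi>)) (\<lambda>_. \<pi>) (\<lambda>k \<omega>. \<omega> k) UNIV"
proof -
  let ?P = "PiM (UNIV :: 'i set) (\<lambda>_. \<pi>)"
  interpret P: prob_space ?P using assms by (intro prob_space_PiM)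
  have "distr ?P \<pi> (\<lambda>\<omega>. \<omega> i) = \<pi>" for i
    using distr_PiM_component[of UNIV "\<lambda>_. \<pi>" i] assms by simp
  then show ?thesis
    by (subst P.indep_vars_iff_distr_eq_PiM') (auto simp: distr_id restrict_UNIV)
qed

text \<open>Markov's inequality for the exponential of \<open>s\<close> times the sum, whose
  expectation factorises by independence.\<close>

lemma partial_sums_chernoff:
  fixes V :: "'b \<Rightarrow> real"
  assumes "prob_space \<pi>" and [measurable]: "V \<in> borel_measurable \<pi>"
    and s: "s > 0" "integrable \<pi> (\<lambda>x. exp (s * V x))"
  shows "measure (PiM UNIV (\<lambda>_. \<pi>)) {\<omega> \<in> space (PiM UNIV (\<lambda>_. \<pi>)). 0 \<le> (\<Sum>k=n..<m. V (\<omega> k))}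
     \<le> (\<integral>x. exp (s * V x) \<partial>\<pi>) ^ (m - n)"
proof -
  let ?P = "PiM UNIV (\<lambda>_::nat. \<pi>)"
  interpret P: prob_space ?P using assms by (intro prob_space_PiM)
  define f where "f k \<omega> = exp (s * V (\<omega> k))" for k :: nat and \<omega>
  have f_pos: "f k \<omega> > 0" for k \<omega> by (simp add: f_def)
  have dist: "distr ?P \<pi> (\<lambda>\<omega>. \<omega> i) = \<pi>" for i
    using distr_PiM_component[of UNIV "\<lambda>_. \<pi>" i] assms by simp
  have ind: "P.indep_vars (\<lambda>_. borel) f {n..<m}"
    unfolding f_def
    by (rule P.indep_vars_compose2[OF P.indep_vars_subset[OF indep_vars_coordinates[OF assms(1)]]]) auto
  have meas[measurable]: "(\<lambda>\<omega>. \<omega> k) \<in> measurable ?P \<pi>" for k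
    by (rule measurable_component_singleton) simp
  have int: "integrable ?P (f k)" for k
    unfolding f_def
    by (rule integrable_distr[of "\<lambda>\<omega>. \<omega> k" ?P \<pi> "\<lambda>x. exp (s * V x)"]) (use s dist in auto)
  have eq: "(\<integral>\<omega>. f k \<omega> \<partial>?P) = (\<integral>x. exp (s * V x) \<partial>\<pi>)" for k
    unfolding f_def
    using integral_distr[of "\<lambda>\<omega>. \<omega> k" ?P \<pi> "\<lambda>x. exp (s * V x)"] dist by simp
  have "{\<omega> \<in> space ?P. 0 \<le> (\<Sum>k=n..<m. V (\<omega> k))} = {\<omega> \<in> space ?P. 1 \<le> (\<Prod>k=n..<m. f k \<omega>)}"
    using s by (auto simp: f_def zero_le_mult_iff simp flip: exp_sum sum_distrib_left)
  also have "P.prob \<dots> \<le> (\<integral>\<omega>. (\<Prod>k=n..<m. f k \<omega>) \<partial>?P) / 1"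
    using ind int
    by (intro integral_Markov_inequality_measure[where A="{}"] P.indep_vars_integrable)
      (auto intro!: prod_nonneg AE_I2 less_imp_le[OF f_pos])
  also have "\<dots> = (\<integral>x. exp (s * V x) \<partial>\<pi>) ^ (m - n)"
    using ind int by (simp add: P.indep_vars_lebesgue_integral eq)
  finally show ?thesis .
qed

text \<open>Borel-Cantelli runs over the starts \<open>n\<close> only. The event at \<open>n\<close>
  collects the bad windows of all lengths, so one threshold \<open>N\<close> serves every end
  \<open>m\<close>.\<close>

lemma AE_windows_negative:
  fixes V :: "'b \<Rightarrow> real"
  assumes "prob_space \<pi>" and [measurable]: "V \<in> borel_measurable \<pi>" and "integrable \<pi> V"
    and "A > 0" "integrable \<pi> (\<lambda>x. exp (A * \<bar>V x\<bar>))" and "(\<integral>x. V x \<partial>\<pi>) < 0"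
  shows "\<exists>K\<ge>0. AE \<omega> in PiM UNIV (\<lambda>_. \<pi>). \<exists>N. \<forall>n\<ge>N. \<forall>m\<ge>n. real n + K * ln (real n) \<le> real m \<longrightarrow>
            (\<Sum>k=n..<m. V (\<omega> k)) < 0"
proof -
  let ?P = "PiM UNIV (\<lambda>_::nat. \<pi>)"
  interpret prob_space \<pi> by fact
  interpret P: prob_space ?P using assms by (intro prob_space_PiM)
  have meas[measurable]: "(\<lambda>\<omega>. \<omega> k) \<in> measurable ?P \<pi>" for k
    by (rule measurable_component_singleton) simp
  obtain s where s: "s > 0" "integrable \<pi> (\<lambda>x. exp (s * V x))" "expectation (\<lambda>x. exp (s * V x)) < 1"
    using exp_moment_less_1[OF assms(2-6)] by blast
  \<comment> \<open>The maximum with \<open>1/2\<close> makes \<open>q > 0\<close> immediate.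
    \<open>K\<close> is chosen so that \<open>sqrt q\<close> to the power \<open>K * ln n\<close>
    equals \<open>1 / n\<^sup>2\<close>.\<close>
  define q where "q = max (1/2) (expectation (\<lambda>x. exp (s * V x)))"
  have q: "0 < q" "q < 1" using s(3) by (auto simp: q_def)
  define K where "K = 4 / (- ln q)"
  have K: "K \<ge> 0" using q by (simp add: K_def)
  define B where "B n L = (if K * ln (real n) \<le> real L
       then {\<omega> \<in> space ?P. 0 \<le> (\<Sum>k=n..<n+L. V (\<omega> k))} else {})" for n L
  have B[measurable]: "B n L \<in> sets ?P" for n L unfolding B_def by simp
  have sq: "0 < sqrt q" "sqrt q < 1" using q by auto
  have PB: "P.prob (B n L) \<le> (1 / real n ^ 2) * sqrt q ^ L" if "n \<ge> 1" for n L
  proof (cases "K * ln (real n) \<le> real L")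
    case True
    have "P.prob (B n L) \<le> expectation (\<lambda>x. exp (s * V x)) ^ L"
      using partial_sums_chernoff[OF assms(1,2) s(1,2), of n "n + L"] True by (simp add: B_def)
    also have "\<dots> \<le> q ^ L"
      by (intro power_mono) (auto simp: q_def)
    \<comment> \<open>One factor pays for the sum over the starts, the other for the sum over the
      lengths.\<close>
    also have "\<dots> = sqrt q ^ L * sqrt q ^ L"
      using q by (simp flip: power_mult_distrib)
    also have "\<dots> \<le> (1 / real n ^ 2) * sqrt q ^ L"
    proof (intro mult_right_mono)
      have "2 * ln (real n) \<le> - ln q / 2 * real L"
        using True q by (simp add: K_def field_simps)
      have "ln (sqrt q ^ L) = real L * (ln q / 2)"
        using q by (simp add: ln_realpow ln_sqrt)
      also have "\<dots> \<le> - 2 * ln (real n)"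
        using \<open>2 * ln (real n) \<le> - ln q / 2 * real L\<close> by (simp add: algebra_simps)
      also have "\<dots> = ln (1 / real n ^ 2)" using that by (simp add: ln_div ln_realpow)
      finally show "sqrt q ^ L \<le> 1 / real n ^ 2"
        using sq that by (subst (asm) ln_le_cancel_iff) auto
    qed (use q in auto)
    finally show ?thesis .
  next
    case False
    then show ?thesis using q by (simp add: B_def)
  qed
  \<comment> \<open>The shift by \<open>Suc\<close> skips the start \<open>0\<close>, at which
    \<open>1 / real n ^ 2\<close> would take the default value \<open>0\<close>.\<close>
  define U where "U n = (\<Union>L. B (Suc n) L)" for n
  have U[measurable]: "U n \<in> sets ?P" for n unfolding U_def by measurable
  have geo: "summable (\<lambda>L. sqrt q ^ L)" using sq by (intro summable_geometric) auto
  have PU: "P.prob (U n) \<le> 1 / real (Suc n) ^ 2 * (1 / (1 - sqrt q))" for n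
  proof -
    have sm: "summable (\<lambda>L. (1 / real (Suc n) ^ 2) * sqrt q ^ L)"
      by (intro summable_mult geo)
    have sB: "summable (\<lambda>L. P.prob (B (Suc n) L))"
      by (rule summable_comparison_test'[OF sm, of 0]) (use PB[of "Suc n"] in auto)
    have "P.prob (U n) \<le> (\<Sum>L. P.prob (B (Suc n) L))"
      unfolding U_def by (intro P.finite_measure_subadditive_countably sB) auto
    also have "\<dots> \<le> (\<Sum>L. (1 / real (Suc n) ^ 2) * sqrt q ^ L)"
      by (intro suminf_le sB sm PB) auto
    also have "\<dots> = 1 / real (Suc n) ^ 2 * (1 / (1 - sqrt q))"
      using sq by (subst suminf_mult[OF geo]) (simp add: suminf_geometric)
    finally show ?thesis .
  qed
  have sumU: "summable (\<lambda>n. P.prob (U n))"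
  proof (rule summable_comparison_test'[of "\<lambda>n. 1 / real (Suc n) ^ 2 * (1 / (1 - sqrt q))" 0])
    have "summable (\<lambda>n. inverse (real (Suc n) ^ 2))"
      using inverse_power_summable[of 2, where ?'a=real] by (subst summable_Suc_iff) auto
    then show "summable (\<lambda>n. 1 / real (Suc n) ^ 2 * (1 / (1 - sqrt q)))"
      by (intro summable_mult2) (simp add: inverse_eq_divide)
  qed (use PU in auto)
  have "AE \<omega> in ?P. eventually (\<lambda>n. \<omega> \<in> space ?P - U n) sequentially"
    by (intro borel_cantelli_AE1 sumU) (auto simp: P.emeasure_eq_measure)
  then have "AE \<omega> in ?P. \<exists>N. \<forall>n\<ge>N. \<forall>m\<ge>n. real n + K * ln (real n) \<le> real m \<longrightarrow>
            (\<Sum>k=n..<m. V (\<omega> k)) < 0"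
  proof (rule AE_mp, intro AE_I2 impI)
    fix \<omega> assume "eventually (\<lambda>n. \<omega> \<in> space ?P - U n) sequentially"
    then obtain N where N: "\<And>n. n \<ge> N \<Longrightarrow> \<omega> \<in> space ?P \<and> \<omega> \<notin> U n"
      by (auto simp: eventually_sequentially)
    show "\<exists>N. \<forall>n\<ge>N. \<forall>m\<ge>n. real n + K * ln (real n) \<le> real m \<longrightarrow> (\<Sum>k=n..<m. V (\<omega> k)) < 0"
    proof (intro exI[of _ "Suc N"] allI impI)
      fix n m assume nm: "Suc N \<le> n" "n \<le> m" "real n + K * ln (real n) \<le> real m"
      then obtain n' where n': "n = Suc n'" "N \<le> n'" by (cases n) auto
      have "\<omega> \<notin> B n (m - n)" using N[OF n'(2)] n'(1) by (auto simp: U_def)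
      then show "(\<Sum>k=n..<m. V (\<omega> k)) < 0"
        using nm N[OF n'(2)] by (auto simp: B_def of_nat_diff split: if_splits)
    qed
  qed
  then show ?thesis using K by blast
qed

text \<open>A two-sided deviation bound is negativity of the window sums of
  \<open>\<sigma> * (W - e) - \<epsilon>\<close> for both signs \<open>\<sigma>\<close>; these
  variables have expectation \<open>- \<epsilon>\<close>.\<close>

lemma AE_window_law:
  fixes W :: "'b \<Rightarrow> real"
  assumes "prob_space \<pi>" and [measurable]: "W \<in> borel_measurable \<pi>"
    and A: "A > 0" "integrable \<pi> (\<lambda>x. exp (A * \<bar>W x\<bar>))"
  shows "integrable \<pi> W"
    and "AE \<omega> in PiM UNIV (\<lambda>_. \<pi>). window_law (\<lambda>n. W (\<omega> n)) (\<integral>x. W x \<partial>\<pi>)"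
proof -
  interpret prob_space \<pi> by fact
  show int: "integrable \<pi> W"
  proof (rule Bochner_Integration.integrable_bound)
    show "integrable \<pi> (\<lambda>x. exp (A * \<bar>W x\<bar>) / A)" using A by simp
    have "\<bar>W x\<bar> \<le> exp (A * \<bar>W x\<bar>) / A" for x
      using exp_ge_add_one_self[of "A * \<bar>W x\<bar>"] A
      unfolding pos_le_divide_eq[OF A(1)] mult.commute[of _ A] by linarith
    then show "AE x in \<pi>. norm (W x) \<le> norm (exp (A * \<bar>W x\<bar>) / A)"
      using A by (intro AE_I2) auto
  qed measurable
  let ?P = "PiM UNIV (\<lambda>_::nat. \<pi>)"
  define e where "e = expectation W"
  have dev: "\<exists>K\<ge>0. AE \<omega> in ?P. \<exists>N. \<forall>n\<ge>N. \<forall>m\<ge>n. real n + K * ln (real n) \<le> real m \<longrightarrow>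
            (\<Sum>k=n..<m. \<sigma> * (W (\<omega> k) - e) - \<epsilon>) < 0" if \<sigma>: "\<bar>\<sigma>\<bar> = 1" and \<epsilon>: "\<epsilon> > 0" for \<sigma> \<epsilon> :: real
  proof (rule AE_windows_negative[OF assms(1), of "\<lambda>x. \<sigma> * (W x - e) - \<epsilon>" A])
    show "integrable \<pi> (\<lambda>x. exp (A * \<bar>\<sigma> * (W x - e) - \<epsilon>\<bar>))"
    proof (rule Bochner_Integration.integrable_bound)
      show "integrable \<pi> (\<lambda>x. exp (A * \<bar>W x\<bar>) * exp (A * (\<bar>e\<bar> + \<epsilon>)))" using A by simp
      have "\<bar>\<sigma> * (W x - e) - \<epsilon>\<bar> \<le> \<bar>W x\<bar> + (\<bar>e\<bar> + \<epsilon>)" for x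
        using \<sigma> \<epsilon> by (auto simp: abs_if split: if_splits)
      then have "A * \<bar>\<sigma> * (W x - e) - \<epsilon>\<bar> \<le> A * (\<bar>W x\<bar> + (\<bar>e\<bar> + \<epsilon>))" for x
        using A by (intro mult_left_mono) auto
      then show "AE x in \<pi>. norm (exp (A * \<bar>\<sigma> * (W x - e) - \<epsilon>\<bar>))
          \<le> norm (exp (A * \<bar>W x\<bar>) * exp (A * (\<bar>e\<bar> + \<epsilon>)))"
        by (intro AE_I2) (simp add: algebra_simps flip: exp_add)
    qed measurable
    show "expectation (\<lambda>x. \<sigma> * (W x - e) - \<epsilon>) < 0"
      using int \<epsilon> by (simp add: prob_space e_def)
  qed (use int A in auto)
  have one: "AE \<omega> in ?P. \<exists>K N. \<forall>n\<ge>N. \<forall>m. real n + K * ln (real n) \<le> real m \<longrightarrow>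
        \<bar>(\<Sum>k=n..<m. W (\<omega> k)) - (real m - real n) * e\<bar> \<le> \<epsilon> * (real m - real n)" if \<epsilon>: "\<epsilon> > 0" for \<epsilon>
  proof -
    obtain K1 where K1: "K1 \<ge> 0" "AE \<omega> in ?P. \<exists>N. \<forall>n\<ge>N. \<forall>m\<ge>n. real n + K1 * ln (real n) \<le> real m \<longrightarrow>
            (\<Sum>k=n..<m. 1 * (W (\<omega> k) - e) - \<epsilon>) < 0" using dev[of 1 \<epsilon>] \<epsilon> by auto
    obtain K2 where K2: "K2 \<ge> 0" "AE \<omega> in ?P. \<exists>N. \<forall>n\<ge>N. \<forall>m\<ge>n. real n + K2 * ln (real n) \<le> real m \<longrightarrow>
            (\<Sum>k=n..<m. (-1) * (W (\<omega> k) - e) - \<epsilon>) < 0" using dev[of "-1" \<epsilon>] \<epsilon> by auto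
    show ?thesis
      using K1(2) K2(2)
    proof eventually_elim
      case (elim \<omega>)
      then obtain N1 N2 where
        N1: "\<And>n m. n \<ge> N1 \<Longrightarrow> m \<ge> n \<Longrightarrow> real n + K1 * ln (real n) \<le> real m \<Longrightarrow>
            (\<Sum>k=n..<m. 1 * (W (\<omega> k) - e) - \<epsilon>) < 0" and
        N2: "\<And>n m. n \<ge> N2 \<Longrightarrow> m \<ge> n \<Longrightarrow> real n + K2 * ln (real n) \<le> real m \<Longrightarrow>
            (\<Sum>k=n..<m. (-1) * (W (\<omega> k) - e) - \<epsilon>) < 0" by blast
      show ?case
      proof (intro exI[of _ "max K1 K2"] exI[of _ "max 1 (max N1 N2)"] allI impI)
        fix n m assume n: "max 1 (max N1 N2) \<le> n" and m: "real n + max K1 K2 * ln (real n) \<le> real m"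
        \<comment> \<open>With a nonnegative logarithm the larger factor gives the stronger length
          condition, so both one-sided bounds apply.\<close>
        have ln: "ln (real n) \<ge> 0" using n by simp
        have "K1 * ln (real n) \<le> max K1 K2 * ln (real n)" "K2 * ln (real n) \<le> max K1 K2 * ln (real n)"
          "0 \<le> max K1 K2 * ln (real n)"
          using ln K1(1) by (auto intro!: mult_right_mono mult_nonneg_nonneg)
        then have "m \<ge> n" "real n + K1 * ln (real n) \<le> real m" "real n + K2 * ln (real n) \<le> real m"
          using m by linarith+
        with N1[of n m] N2[of n m] n
        show "\<bar>(\<Sum>k=n..<m. W (\<omega> k)) - (real m - real n) * e\<bar> \<le> \<epsilon> * (real m - real n)"
          by (simp add: sum_subtractf sum_negf sum.distrib of_nat_diff abs_le_iff algebra_simps)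
      qed
    qed
  qed
  \<comment> \<open>The null set depends on \<open>\<epsilon>\<close>; the values
    \<open>1 / (j + 1)\<close> are countably many and suffice.\<close>
  have "AE \<omega> in ?P. \<forall>j. \<exists>K N. \<forall>n\<ge>N. \<forall>m. real n + K * ln (real n) \<le> real m \<longrightarrow>
        \<bar>(\<Sum>k=n..<m. W (\<omega> k)) - (real m - real n) * e\<bar> \<le> inverse (real (Suc j)) * (real m - real n)"
    using one by (subst AE_all_countable) (simp del: of_nat_Suc)
  then have "AE \<omega> in ?P. window_law (\<lambda>n. W (\<omega> n)) e"
  proof eventually_elim
    case (elim \<omega>)
    show ?case
      unfolding window_law_def
    proof (intro allI impI)
      fix \<epsilon> :: real assume "\<epsilon> > 0"
      then obtain j where j: "inverse (real (Suc j)) < \<epsilon>" using reals_Archimedean by blast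
      obtain K N where KN: "\<And>n m. n \<ge> N \<Longrightarrow> real n + K * ln (real n) \<le> real m \<Longrightarrow>
        \<bar>(\<Sum>k=n..<m. W (\<omega> k)) - (real m - real n) * e\<bar> \<le> inverse (real (Suc j)) * (real m - real n)"
        using elim by blast
      show "\<exists>K N. \<forall>n\<ge>N. \<forall>m. real n + K * ln (real n) \<le> real m \<longrightarrow>
        \<bar>(\<Sum>k=n..<m. W (\<omega> k)) - (real m - real n) * e\<bar> \<le> \<epsilon> * (real m - real n)"
      proof (intro exI[of _ K] exI[of _ N] allI impI)
        fix n m assume nm: "N \<le> n" "real n + K * ln (real n) \<le> real m"
        \<comment> \<open>The inequality \<open>n \<le> m\<close> is not part of
          \<open>window_law\<close>, but the bound forces it: a positive multiple of
          \<open>real m - real n\<close> dominates an absolute value.\<close>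
        have "0 \<le> inverse (real (Suc j)) * (real m - real n)"
          using KN[OF nm] by linarith
        then have "real m - real n \<ge> 0" by (simp add: zero_le_mult_iff del: of_nat_Suc)
        then show "\<bar>(\<Sum>k=n..<m. W (\<omega> k)) - (real m - real n) * e\<bar> \<le> \<epsilon> * (real m - real n)"
          using KN[OF nm] mult_right_mono[of "inverse (real (Suc j))" \<epsilon> "real m - real n"] j by linarith
      qed
    qed
  qed
  then show "AE \<omega> in ?P. window_law (\<lambda>n. W (\<omega> n)) (expectation W)" by (simp add: e_def)
qed

section \<open>Balls and Moran sets\<close>

text \<open>One \<open>\<omega>\<close> is fixed, with any admissible selection \<open>J\<close>.
  Randomness enters the results below only through \<open>window_law\<close> hypotheses on its
  coordinates.\<close>

locale moran_tree =
  fixes \<tau> :: real and I0 :: "'a::heine_borel set" and \<rho> :: "nat \<Rightarrow> real"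
    and \<omega> :: "nat \<Rightarrow> step" and J :: "nat list \<Rightarrow> 'a set" and M :: "'a measure"
  assumes compact_I0: "compact I0" and diameter_I0: "diameter I0 = 1"
    and \<tau>: "0 < \<tau>" "\<tau> < 1"
    and \<rho>: "\<And>t. 1 \<le> t \<Longrightarrow> \<rho> t \<le> 1/2"
    and \<omega>: "\<And>n. \<omega> n \<in> Omega0 \<rho>"
    and family: "moran_family \<tau> I0 \<omega> J"
    and moran_measure: "is_moran_measure \<omega> J M"
begin

sublocale prob_space M
  using moran_measure by (simp add: is_moran_measure_def)

text \<open>By \<open>moran_piece\<close>, this is the common diameter of all Moran sets of step
  \<open>n\<close>.\<close>

definition D :: "nat \<Rightarrow> real" where
  "D n = (\<Prod>k<n. ratio (\<omega> k))"

abbreviation words :: "nat \<Rightarrow> nat list set" where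
  "words \<equiv> moran_words \<omega>"

lemma ratio_pos: "0 < ratio (\<omega> k)" and ratio_le: "ratio (\<omega> k) \<le> 1/2"
  and num_children_ge: "2 \<le> num_children (\<omega> k)"
  and weight_pos: "j < num_children (\<omega> k) \<Longrightarrow> 0 < weight (\<omega> k) j"
proof -
  show "2 \<le> num_children (\<omega> k)" "0 < ratio (\<omega> k)"
    "j < num_children (\<omega> k) \<Longrightarrow> 0 < weight (\<omega> k) j"
    using \<omega>[of k] by (auto simp: Omega0_def)
  show "ratio (\<omega> k) \<le> 1/2"
    using \<omega>[of k] \<rho>[of "num_children (\<omega> k)"] by (auto simp: Omega0_def)
qed

lemma D_0 [simp]: "D 0 = 1" by (simp add: D_def)

lemma D_Suc: "D (Suc n) = D n * ratio (\<omega> n)" by (simp add: D_def)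

lemma D_pos: "0 < D n"
  unfolding D_def by (intro prod_pos) (auto intro: ratio_pos)

lemma D_Suc_le: "D (Suc n) \<le> D n / 2"
  using mult_left_mono[OF ratio_le less_imp_le[OF D_pos]] by (simp add: D_Suc)

lemma D_le: "D n \<le> (1/2) ^ n"
  using D_Suc_le by (induction n) (auto intro: order_trans)

lemma D_antimono: "n \<le> m \<Longrightarrow> D m \<le> D n"
proof (induction m rule: dec_induct)
  case (step m)
  then show ?case using D_Suc_le[of m] D_pos[of m] by simp
qed simp

lemma D_tendsto_0: "D \<longlonglongrightarrow> 0"
  by (rule tendsto_sandwich[OF always_eventually always_eventually tendsto_const
        LIMSEQ_realpow_zero[of "1/2"]]) (auto intro: D_le less_imp_le[OF D_pos])

lemma D_eq_exp:
  assumes "n \<le> m"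
  shows "D n = D m * exp (\<Sum>k=n..<m. Z_val (\<omega> k))"
  using assms
proof (induction m rule: dec_induct)
  case (step m)
  have "ratio (\<omega> m) * exp (Z_val (\<omega> m)) = 1"
    using ratio_pos[of m] by (simp add: Z_val_def exp_minus)
  then show ?case using step by (simp add: D_Suc exp_add)
qed simp

lemma D_le_exp: "D n \<le> exp (- (real n * ln 2))"
proof -
  have "(1/2) ^ n = exp (- (real n * ln 2) :: real)"
    by (simp add: exp_minus exp_of_nat_mult power_one_over inverse_eq_divide)
  then show ?thesis using D_le[of n] by simp
qed

section \<open>Addresses, Moran pieces and their separation\<close>

lemma words_0 [simp]: "words 0 = {[]}"
  by (auto simp: moran_words_def)

lemma words_Suc:
  "w \<in> words (Suc n) \<longleftrightarrow> (\<exists>v j. w = v @ [j] \<and> v \<in> words n \<and> j < num_children (\<omega> n))"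
proof
  assume w: "w \<in> words (Suc n)"
  then have "w = butlast w @ [last w]"
    by (intro append_butlast_last_id[symmetric]) (auto simp: moran_words_def)
  moreover have "butlast w \<in> words n" "last w < num_children (\<omega> n)"
  proof -
    have "last w = w ! n"
      using w last_conv_nth[of w] by (cases "w = []") (auto simp: moran_words_def)
    then show "butlast w \<in> words n" "last w < num_children (\<omega> n)"
      using w by (auto simp: moran_words_def nth_butlast)
  qed
  ultimately show "\<exists>v j. w = v @ [j] \<and> v \<in> words n \<and> j < num_children (\<omega> n)" by blast
qed (auto simp: moran_words_def nth_append less_Suc_eq)

lemma take_words: "w \<in> words m \<Longrightarrow> n \<le> m \<Longrightarrow> take n w \<in> words n"
  by (auto simp: moran_words_def)

lemma child:
  assumes "w \<in> words n" "j < num_children (\<omega> n)"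
  shows "is_r_similarity (ratio (\<omega> n)) (J w) (J (w @ [j]))"
  using family assms by (auto simp: moran_family_def separated_similarities_def)

lemma children_separated:
  assumes "w \<in> words n" "i < num_children (\<omega> n)" "j < num_children (\<omega> n)" "i \<noteq> j"
  shows "\<tau> * ratio (\<omega> n) * diameter (J w) \<le> setdist (J (w @ [i])) (J (w @ [j]))"
  using family assms by (auto simp: moran_family_def separated_similarities_def)

lemma moran_piece:
  assumes "w \<in> words n"
  shows "compact (J w) \<and> J w \<noteq> {} \<and> diameter (J w) = D n"
  using assms
proof (induction n arbitrary: w)
  case 0
  then show ?case
    using family compact_I0 diameter_I0 by (auto simp: moran_family_def)
next
  case (Suc n)
  then obtain v j where w: "w = v @ [j]" "v \<in> words n" "j < num_children (\<omega> n)"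
    by (auto simp: words_Suc)
  obtain S c where S: "J w = S ` J v" "\<And>x y. dist (S x) (S y) = c * dist x y" "c > 0"
    "diameter (J w) = ratio (\<omega> n) * diameter (J v)"
    using child[OF w(2,3)] w(1) unfolding is_r_similarity_def similarity_def by metis
  have "continuous_on (J v) S"
  proof (rule continuous_onI)
    fix y and \<epsilon> :: real assume "0 < \<epsilon>"
    then show "\<exists>d>0. \<forall>x'\<in>J v. dist x' y < d \<longrightarrow> dist (S x') (S y) \<le> \<epsilon>"
      using S(2,3) by (intro exI[of _ "\<epsilon> / c"]) (auto simp: field_simps intro: less_imp_le)
  qed
  then show ?case
    using Suc.IH[OF w(2)] S by (auto simp: D_Suc intro: compact_continuous_image)
qed

lemma piece_borel: "w \<in> words n \<Longrightarrow> J w \<in> sets M"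
  using moran_piece[of w n] moran_measure by (simp add: is_moran_measure_def borel_compact)

lemma dist_le_D: "w \<in> words n \<Longrightarrow> x \<in> J w \<Longrightarrow> y \<in> J w \<Longrightarrow> dist x y \<le> D n"
  using moran_piece[of w n] diameter_bounded_bound[of "J w" x y] by (auto dest: compact_imp_bounded)

lemma piece_subset_take:
  assumes "w \<in> words m" "n \<le> m"
  shows "J w \<subseteq> J (take n w)"
  using assms(2,1)
proof (induction m arbitrary: w rule: dec_induct)
  case base
  then show ?case by (simp add: moran_words_def)
next
  case (step m)
  then obtain v j where w: "w = v @ [j]" "v \<in> words m" "j < num_children (\<omega> m)"
    by (auto simp: words_Suc)
  have "J w \<subseteq> J v"
    using child[OF w(2,3)] w(1) by (simp add: is_r_similarity_def)
  moreover have "take n w = take n v" using w step by (simp add: moran_words_def)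
  ultimately show ?case using step.IH[OF w(2)] by auto
qed

text \<open>Separation of siblings gives the bound at the generation where the two addresses part;
  afterwards \<open>D\<close> only decreases.\<close>

lemma separation:
  assumes "u \<in> words n" "v \<in> words n" "u \<noteq> v" "x \<in> J u" "y \<in> J v"
  shows "\<tau> * D n \<le> dist x y"
  using assms
proof (induction n arbitrary: u v)
  case 0
  then show ?case by simp
next
  case (Suc n)
  obtain u' i where u: "u = u' @ [i]" "u' \<in> words n" "i < num_children (\<omega> n)"
    using Suc.prems(1) by (auto simp: words_Suc)
  obtain v' j where v: "v = v' @ [j]" "v' \<in> words n" "j < num_children (\<omega> n)"
    using Suc.prems(2) by (auto simp: words_Suc)
  show ?case
  proof (cases "u' = v'")
    case True
    with u v Suc.prems have "\<tau> * ratio (\<omega> n) * diameter (J u') \<le> setdist (J u) (J v)"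
      using children_separated[of u' n i j] by auto
    also have "\<dots> \<le> dist x y" using Suc.prems by (intro setdist_le_dist)
    finally show ?thesis using moran_piece[OF u(2)] by (simp add: D_Suc mult_ac)
  next
    case False
    have "x \<in> J u'" "y \<in> J v'"
      using child[OF u(2,3)] child[OF v(2,3)] Suc.prems u(1) v(1) by (auto simp: is_r_similarity_def)
    then have "\<tau> * D n \<le> dist x y" using Suc.IH[OF u(2) v(2) False] by simp
    moreover have "\<tau> * D (Suc n) \<le> \<tau> * D n"
      using \<tau> D_antimono[of n "Suc n"] by simp
    ultimately show ?thesis by simp
  qed
qed

section \<open>Masses of pieces and of balls\<close>

lemma measure_piece:
  assumes "w \<in> words n"
  shows "measure M (J w) = (\<Prod>k<n. weight (\<omega> k) (w ! k))"
  using assms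
proof (induction n arbitrary: w)
  case 0
  then show ?case using moran_measure by (simp add: is_moran_measure_def)
next
  case (Suc n)
  then obtain v j where w: "w = v @ [j]" "v \<in> words n" "j < num_children (\<omega> n)"
    by (auto simp: words_Suc)
  have "length v = n" using w by (simp add: moran_words_def)
  then have "(\<Prod>k<n. weight (\<omega> k) (w ! k)) = (\<Prod>k<n. weight (\<omega> k) (v ! k))"
    by (intro prod.cong) (auto simp: w nth_append)
  moreover have "measure M (J w) = measure M (J v) * weight (\<omega> n) j"
    using moran_measure w by (auto simp: is_moran_measure_def)
  ultimately show ?case using Suc.IH[OF w(2)] w \<open>length v = n\<close> by (simp add: nth_append)
qed

lemma measure_piece_pos:
  assumes "w \<in> words n" shows "0 < measure M (J w)"
  unfolding measure_piece[OF assms] using assms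
  by (intro prod_pos) (auto intro!: weight_pos simp: moran_words_def)

lemma measure_piece_take:
  assumes "w \<in> words m" "n \<le> m"
  shows "measure M (J w) = measure M (J (take n w)) * (\<Prod>k=n..<m. weight (\<omega> k) (w ! k))"
proof -
  have "(\<Prod>k<m. weight (\<omega> k) (w ! k)) =
      (\<Prod>k<n. weight (\<omega> k) (w ! k)) * (\<Prod>k=n..<m. weight (\<omega> k) (w ! k))"
    using assms(2) prod.atLeastLessThan_concat[of 0 n m "\<lambda>k. weight (\<omega> k) (w ! k)"]
    by (simp add: atLeast0LessThan)
  then show ?thesis
    using assms by (simp add: measure_piece[OF assms(1)] measure_piece[OF take_words[OF assms]])
qed

lemma sets_ball [measurable]: "ball x r \<in> sets M"
  using moran_measure by (simp add: is_moran_measure_def)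

text \<open>The inequality \<open>D n < R\<close> is strict because the ball is open, while two
  points of the piece may be at distance exactly \<open>D n\<close>.\<close>

lemma measure_ball_ge:
  assumes "w \<in> words n" "x \<in> J w" "D n < R"
  shows "measure M (J w) \<le> measure M (ball x R)"
  using dist_le_D[OF assms(1,2)] assms(3) by (intro finite_measure_mono) force+

lemma AE_moran_set: "AE x in M. x \<in> moran_set \<omega> J"
  using moran_measure by (simp add: is_moran_measure_def)

text \<open>Every other piece of step \<open>n\<close> is at distance at least
  \<open>\<tau> * D n\<close> from \<open>x\<close> and misses the open ball. The inclusion is only
  almost sure, since the ball may contain points outside the Moran set.\<close>

lemma measure_ball_le:
  assumes "w \<in> words n" "x \<in> J w" "R \<le> \<tau> * D n"
  shows "measure M (ball x R) \<le> measure M (J w)"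
proof (rule finite_measure_mono_AE)
  show "AE y in M. y \<in> ball x R \<longrightarrow> y \<in> J w"
    using AE_moran_set
  proof eventually_elim
    case (elim y)
    then obtain v where v: "v \<in> words n" "y \<in> J v" by (auto simp: moran_set_def)
    show ?case
      using separation[OF assms(1) v(1) _ assms(2) v(2)] v(2) assms(3) by (cases "w = v") auto
  qed
qed (use piece_borel[OF assms(1)] in auto)

section \<open>The support and its points\<close>

lemma finite_words: "finite (words n)"
proof (induction n)
  case (Suc n)
  have "words (Suc n) = (\<lambda>(v, j). v @ [j]) ` (words n \<times> {..<num_children (\<omega> n)})"
    by (auto simp: words_Suc)
  then show ?case using Suc by simp
qed simp

text \<open>The pieces of one step form a finite union of compact sets, hence a closed set, and it
  carries all the mass; its complement is open and null.\<close>

lemma support_in_piece: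
  assumes "x \<in> measure_support M"
  shows "\<exists>w\<in>words n. x \<in> J w"
proof (rule ccontr)
  assume neg: "\<not> (\<exists>w\<in>words n. x \<in> J w)"
  define E where "E = (\<Union>w\<in>words n. J w)"
  have "closed E"
    unfolding E_def using finite_words moran_piece by (intro closed_UN) (auto intro: compact_imp_closed)
  moreover have "x \<in> - E" using neg by (auto simp: E_def)
  ultimately obtain r where r: "r > 0" "ball x r \<subseteq> - E"
    using openE[of "- E" x] by (auto simp: open_Compl)
  have "AE y in M. y \<notin> ball x r"
    using AE_moran_set by eventually_elim (use r(2) in \<open>unfold moran_set_def E_def, blast\<close>)
  then have "emeasure M (ball x r) = 0"
    by (subst (asm) AE_iff_measurable[of "ball x r"]) (auto simp: sets_eq_imp_space_eq[of M borel] moran_measure[unfolded is_moran_measure_def])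
  then show False using assms r by (auto simp: measure_support_def)
qed

lemma measure_ball_pos:
  assumes "x \<in> measure_support M" "0 < r" shows "0 < measure M (ball x r)"
  using assms by (simp add: measure_support_def emeasure_eq_measure)

text \<open>The pieces along an infinite address are nested nonempty compact sets. Their common
  point is in the support because every ball around it contains one of them, and pieces have
  positive mass.\<close>

lemma point_of_address:
  assumes f: "\<And>k. f k < num_children (\<omega> k)"
  shows "\<exists>x\<in>measure_support M. \<forall>n. x \<in> J (map f [0..<n])"
proof -
  define F where "F n = J (map f [0..<n])" for n
  have words: "map f [0..<n] \<in> words n" for n
    using f by (simp add: moran_words_def)
  have "(\<Inter>n. F n) \<noteq> {}"
  proof (rule compact_nest)
    fix m n :: nat assume "m \<le> n"
    then have "take m (map f [0..<n]) = map f [0..<m]" by (simp add: take_map)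
    then show "F n \<subseteq> F m"
      using piece_subset_take[OF words \<open>m \<le> n\<close>] by (simp add: F_def)
  qed (use moran_piece[OF words] in \<open>auto simp: F_def\<close>)
  then obtain x where x: "\<And>n. x \<in> F n" by auto
  have "0 < emeasure M (ball x r)" if "r > 0" for r
  proof -
    obtain n where "D n < r"
      using order_tendstoD(2)[OF D_tendsto_0 \<open>r > 0\<close>] by (auto simp: eventually_sequentially)
    then have "measure M (F n) \<le> measure M (ball x r)"
      using measure_ball_ge[OF words] x by (simp add: F_def)
    then show ?thesis
      using measure_piece_pos[OF words[of n]] by (simp add: F_def emeasure_eq_measure)
  qed
  then have "x \<in> measure_support M" by (simp add: measure_support_def)
  then show ?thesis using x by (auto simp: F_def)
qed

text \<open>Two pieces on one address have a mass quotient that telescopes to the weights of the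
  letters in between. The large ball contains the outer piece, and the small ball lies in the inner
  piece up to a null set.\<close>

lemma word_ratio_ge:
  assumes "w \<in> words m" "x \<in> J w" "n \<le> m" "D n < R" "r \<le> \<tau> * D m" "0 < r" "x \<in> measure_support M"
  shows "1 / (\<Prod>k=n..<m. weight (\<omega> k) (w ! k)) \<le> measure M (ball x R) / measure M (ball x r)"
proof -
  have x: "x \<in> J (take n w)" using piece_subset_take assms by blast
  have *: "(\<Prod>k=n..<m. weight (\<omega> k) (w ! k)) > 0"
    using assms(1) by (intro prod_pos) (auto intro!: weight_pos simp: moran_words_def)
  have "1 / (\<Prod>k=n..<m. weight (\<omega> k) (w ! k)) = measure M (J (take n w)) / measure M (J w)"
    using measure_piece_take[OF assms(1,3)] measure_piece_pos[OF take_words[OF assms(1,3)]] by simp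
  also have "\<dots> \<le> measure M (ball x R) / measure M (ball x r)"
    using measure_ball_ge[OF take_words[OF assms(1,3)] x assms(4)] measure_ball_le[OF assms(1,2,5)]
      measure_ball_pos[OF assms(7,6)]
    by (intro frac_le) auto
  finally show ?thesis .
qed

lemma word_ratio_le:
  assumes "w \<in> words m" "x \<in> J w" "n \<le> m" "R \<le> \<tau> * D n" "D m < r"
  shows "measure M (ball x R) / measure M (ball x r) \<le> 1 / (\<Prod>k=n..<m. weight (\<omega> k) (w ! k))"
proof -
  have x: "x \<in> J (take n w)" using piece_subset_take assms by blast
  have "measure M (ball x R) / measure M (ball x r) \<le> measure M (J (take n w)) / measure M (J w)"
    using measure_ball_le[OF take_words[OF assms(1,3)] x assms(4)] measure_ball_ge[OF assms(1,2,5)]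
      measure_piece_pos[OF assms(1)]
    by (intro frac_le) auto
  also have "\<dots> = 1 / (\<Prod>k=n..<m. weight (\<omega> k) (w ! k))"
    using measure_piece_take[OF assms(1,3)] measure_piece_pos[OF take_words[OF assms(1,3)]] by simp
  finally show ?thesis .
qed

section \<open>Extremal weights and the points that realise them\<close>

lemma X_le: "j < num_children (\<omega> k) \<Longrightarrow> exp (X_val (\<omega> k)) \<le> 1 / weight (\<omega> k) j"
proof -
  assume j: "j < num_children (\<omega> k)"
  have "weight (\<omega> k) j \<le> Max (weight (\<omega> k) ` {..<num_children (\<omega> k)})" (is "_ \<le> ?M")
    using j by (intro Max_ge) auto
  then show ?thesis using weight_pos[OF j]
    by (simp add: X_val_def exp_minus inverse_eq_divide frac_le)
qed

lemma Y_ge: "j < num_children (\<omega> k) \<Longrightarrow> 1 / weight (\<omega> k) j \<le> exp (Y_val (\<omega> k))"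
proof -
  assume j: "j < num_children (\<omega> k)"
  let ?m = "Min (weight (\<omega> k) ` {..<num_children (\<omega> k)})"
  have "?m \<le> weight (\<omega> k) j"
    using j by (intro Min_le) auto
  moreover have "?m > 0"
    using j by (subst Min_gr_iff) (auto intro: weight_pos)
  ultimately show ?thesis
    by (simp add: Y_val_def exp_minus inverse_eq_divide frac_le)
qed

lemma X_attained: "\<exists>j<num_children (\<omega> k). 1 / weight (\<omega> k) j = exp (X_val (\<omega> k))"
proof -
  have "Max (weight (\<omega> k) ` {..<num_children (\<omega> k)}) \<in> weight (\<omega> k) ` {..<num_children (\<omega> k)}"
    using num_children_ge[of k] by (intro Max_in) (auto simp: lessThan_empty_iff)
  then obtain j where "j < num_children (\<omega> k)"
    "Max (weight (\<omega> k) ` {..<num_children (\<omega> k)}) = weight (\<omega> k) j" by auto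
  then show ?thesis using weight_pos[of j k]
    by (intro exI[of _ j]) (simp add: X_val_def exp_minus inverse_eq_divide)
qed

lemma Y_attained: "\<exists>j<num_children (\<omega> k). 1 / weight (\<omega> k) j = exp (Y_val (\<omega> k))"
proof -
  have "Min (weight (\<omega> k) ` {..<num_children (\<omega> k)}) \<in> weight (\<omega> k) ` {..<num_children (\<omega> k)}"
    using num_children_ge[of k] by (intro Min_in) (auto simp: lessThan_empty_iff)
  then obtain j where "j < num_children (\<omega> k)"
    "Min (weight (\<omega> k) ` {..<num_children (\<omega> k)}) = weight (\<omega> k) j" by auto
  then show ?thesis using weight_pos[of j k]
    by (intro exI[of _ j]) (simp add: Y_val_def exp_minus inverse_eq_divide)
qed

lemma inverse_prod_weight: "1 / (\<Prod>k=n..<m. weight (\<omega> k) (w ! k)) = (\<Prod>k=n..<m. 1 / weight (\<omega> k) (w ! k))"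
  by (simp add: prod_dividef)

text \<open>Whatever the address of \<open>x\<close>, each generation reduces the mass at least as
  much as passing to the heaviest child does.\<close>

lemma ball_ratio_ge:
  assumes "x \<in> measure_support M" "n \<le> m" "D n < R" "r \<le> \<tau> * D m" "0 < r"
  shows "exp (\<Sum>k=n..<m. X_val (\<omega> k)) \<le> measure M (ball x R) / measure M (ball x r)"
proof -
  obtain w where w: "w \<in> words m" "x \<in> J w" using support_in_piece[OF assms(1)] by blast
  have "exp (\<Sum>k=n..<m. X_val (\<omega> k)) \<le> 1 / (\<Prod>k=n..<m. weight (\<omega> k) (w ! k))"
    unfolding inverse_prod_weight exp_sum[OF finite_atLeastLessThan]
    using w(1) by (intro prod_mono) (auto intro!: X_le simp: moran_words_def)
  also have "\<dots> \<le> measure M (ball x R) / measure M (ball x r)"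
    using word_ratio_ge[OF w assms(2-5,1)] .
  finally show ?thesis .
qed

lemma ball_ratio_le:
  assumes "x \<in> measure_support M" "n \<le> m" "R \<le> \<tau> * D n" "D m < r"
  shows "measure M (ball x R) / measure M (ball x r) \<le> exp (\<Sum>k=n..<m. Y_val (\<omega> k))"
proof -
  obtain w where w: "w \<in> words m" "x \<in> J w" using support_in_piece[OF assms(1)] by blast
  have "measure M (ball x R) / measure M (ball x r) \<le> 1 / (\<Prod>k=n..<m. weight (\<omega> k) (w ! k))"
    using word_ratio_le[OF w assms(2-4)] .
  also have "\<dots> \<le> exp (\<Sum>k=n..<m. Y_val (\<omega> k))"
    unfolding inverse_prod_weight exp_sum[OF finite_atLeastLessThan]
  proof (intro prod_mono conjI)
    fix k assume "k \<in> {n..<m}"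
    then have "w ! k < num_children (\<omega> k)" using w(1) by (simp add: moran_words_def)
    then show "0 \<le> 1 / weight (\<omega> k) (w ! k)" "1 / weight (\<omega> k) (w ! k) \<le> exp (Y_val (\<omega> k))"
      using weight_pos[of "w ! k" k] Y_ge[of "w ! k" k] by simp_all
  qed
  finally show ?thesis .
qed

text \<open>Along the address of maximal weights \<open>X_le\<close> is an equality in every
  generation, so a single point bounds the quotient at all pairs of scales.\<close>

lemma heavy_point:
  "\<exists>x\<in>measure_support M. \<forall>n m R r. n \<le> m \<longrightarrow> R \<le> \<tau> * D n \<longrightarrow> D m < r \<longrightarrow>
     measure M (ball x R) / measure M (ball x r) \<le> exp (\<Sum>k=n..<m. X_val (\<omega> k))"
proof -
  have "\<exists>f. \<forall>k. f k < num_children (\<omega> k) \<and> 1 / weight (\<omega> k) (f k) = exp (X_val (\<omega> k))"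
    by (intro choice allI X_attained)
  then obtain f where f: "\<And>k. f k < num_children (\<omega> k)"
    "\<And>k. 1 / weight (\<omega> k) (f k) = exp (X_val (\<omega> k))" by blast
  obtain x where x: "x \<in> measure_support M" "\<And>n. x \<in> J (map f [0..<n])"
    using point_of_address[OF f(1)] by blast
  have "measure M (ball x R) / measure M (ball x r) \<le> exp (\<Sum>k=n..<m. X_val (\<omega> k))"
    if nm: "n \<le> m" "R \<le> \<tau> * D n" "D m < r" for n m R r
  proof -
    have "map f [0..<m] \<in> words m" using f by (simp add: moran_words_def)
    from word_ratio_le[OF this x(2) nm] show ?thesis
      unfolding inverse_prod_weight exp_sum[OF finite_atLeastLessThan] by (simp add: f(2) cong: prod.cong_simp)
  qed
  then show ?thesis using x(1) by blast
qed

lemma light_point: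
  "\<exists>x\<in>measure_support M. \<forall>n m R r. n \<le> m \<longrightarrow> D n < R \<longrightarrow> 0 < r \<longrightarrow> r \<le> \<tau> * D m \<longrightarrow>
     exp (\<Sum>k=n..<m. Y_val (\<omega> k)) \<le> measure M (ball x R) / measure M (ball x r)"
proof -
  have "\<exists>f. \<forall>k. f k < num_children (\<omega> k) \<and> 1 / weight (\<omega> k) (f k) = exp (Y_val (\<omega> k))"
    by (intro choice allI Y_attained)
  then obtain f where f: "\<And>k. f k < num_children (\<omega> k)"
    "\<And>k. 1 / weight (\<omega> k) (f k) = exp (Y_val (\<omega> k))" by blast
  obtain x where x: "x \<in> measure_support M" "\<And>n. x \<in> J (map f [0..<n])"
    using point_of_address[OF f(1)] by blast
  have "exp (\<Sum>k=n..<m. Y_val (\<omega> k)) \<le> measure M (ball x R) / measure M (ball x r)"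
    if nm: "n \<le> m" "D n < R" "0 < r" "r \<le> \<tau> * D m" for n m R r
  proof -
    have "map f [0..<m] \<in> words m" using f by (simp add: moran_words_def)
    from word_ratio_ge[OF this x(2) nm(1,2,4,3) x(1)] show ?thesis
      unfolding inverse_prod_weight exp_sum[OF finite_atLeastLessThan] by (simp add: f(2) cong: prod.cong_simp)
  qed
  then show ?thesis using x(1) by blast
qed

end

section \<open>\<Phi>-dimensions of a single tree\<close>

text \<open>The law persists for larger factors, so that the factors belonging to two different
  sequences can be replaced by their maximum.\<close>

lemma window_lawD:
  assumes "window_law W e" "\<epsilon> > 0"
  shows "\<exists>K\<^sub>0 N. \<forall>K\<ge>K\<^sub>0. \<forall>n\<ge>N. \<forall>m. real n + K * ln (real n) \<le> real m \<longrightarrow>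
     \<bar>(\<Sum>k=n..<m. W k) - (real m - real n) * e\<bar> \<le> \<epsilon> * (real m - real n)"
proof -
  obtain K N where KN: "\<And>n m. n \<ge> N \<Longrightarrow> real n + K * ln (real n) \<le> real m \<Longrightarrow>
    \<bar>(\<Sum>k=n..<m. W k) - (real m - real n) * e\<bar> \<le> \<epsilon> * (real m - real n)"
    using assms unfolding window_law_def by meson
  show ?thesis
  proof (intro exI[of _ K] exI[of _ "max 1 N"] allI impI)
    fix K' :: real and n m :: nat
    assume *: "K \<le> K'" "max 1 N \<le> n" "real n + K' * ln (real n) \<le> real m"
    have "K * ln (real n) \<le> K' * ln (real n)"
      using * by (intro mult_right_mono) auto
    then show "\<bar>(\<Sum>k=n..<m. W k) - (real m - real n) * e\<bar> \<le> \<epsilon> * (real m - real n)"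
      using * by (intro KN) auto
  qed
qed

lemma one_le_ln: "3 \<le> n \<Longrightarrow> 1 \<le> ln (real n)"
  using exp_le by (subst ln_ge_iff) auto

text \<open>Comparing balls with pieces from outside and from inside gives windows that differ by
  one generation at each end; this is the law for the inner one.\<close>

lemma window_law_shrunkD:
  assumes "window_law W e" "\<epsilon> > 0"
  shows "\<exists>K\<^sub>0 N. \<forall>K\<ge>K\<^sub>0. \<forall>n\<ge>N. \<forall>m. real n + K * ln (real n) \<le> real m \<longrightarrow> Suc n < m \<and>
     \<bar>(\<Sum>k=Suc n..<m - 1. W k) - (real m - real n - 2) * e\<bar> \<le> \<epsilon> * (real m - real n - 2)"
proof -
  obtain K N where KN: "\<And>n m K'. n \<ge> N \<Longrightarrow> K \<le> K' \<Longrightarrow> real n + K' * ln (real n) \<le> real m \<Longrightarrow>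
    \<bar>(\<Sum>k=n..<m. W k) - (real m - real n) * e\<bar> \<le> \<epsilon> * (real m - real n)"
    using window_lawD[OF assms] by blast
  define K1 where "K1 = max 0 K"
  show ?thesis
  proof (intro exI[of _ "2 * K1 + 2"] exI[of _ "max 3 N"] allI impI)
    fix K' :: real and n m :: nat
    assume *: "2 * K1 + 2 \<le> K'" "max 3 N \<le> n" "real n + K' * ln (real n) \<le> real m"
    have ln1: "1 \<le> ln (real n)" using * by (intro one_le_ln) auto
    \<comment> \<open>\<open>n + 1 \<le> n\<^sup>2\<close> gives
      \<open>ln (n + 1) \<le> 2 * ln n\<close>, whence the factor \<open>2 * K1\<close>. The extra
      \<open>2\<close> covers the two lost generations, as \<open>ln n \<ge> 1\<close>.\<close>
    have "3 * real n \<le> real n * real n" using * by (intro mult_right_mono) auto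
    then have "real (Suc n) \<le> real n ^ 2"
      using * unfolding power2_eq_square of_nat_Suc by linarith
    then have "ln (real (Suc n)) \<le> ln (real n ^ 2)"
      using * by (subst ln_le_cancel_iff) auto
    also have "\<dots> = 2 * ln (real n)" using * by (simp add: ln_realpow)
    finally have "K1 * ln (real (Suc n)) \<le> K1 * (2 * ln (real n))"
      by (intro mult_left_mono) (auto simp: K1_def)
    moreover have "(2 * K1 + 2) * ln (real n) \<le> K' * ln (real n)"
      using * ln1 by (intro mult_right_mono) auto
    moreover have "0 \<le> K1 * ln (real n)" using ln1 by (simp add: K1_def)
    ultimately have big: "real (Suc n) + K1 * ln (real (Suc n)) \<le> real m - 1" "real n + 2 \<le> real m"
      using * ln1 by (simp_all add: algebra_simps)
    then have "Suc n < m" by linarith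
    moreover have "real (m - 1) = real m - 1" using \<open>Suc n < m\<close> by (simp add: of_nat_diff)
    moreover have "real m - 1 - real (Suc n) = real m - real n - 2" by simp
    ultimately show "Suc n < m \<and>
       \<bar>(\<Sum>k=Suc n..<m - 1. W k) - (real m - real n - 2) * e\<bar> \<le> \<epsilon> * (real m - real n - 2)"
      using KN[of "Suc n" K1 "m - 1"] big * by (auto simp: K1_def)
  qed
qed

text \<open>This takes the place of the strong law of large numbers: a start \<open>n\<close> below
  the threshold of \<open>window_law\<close> adds only a fixed initial sum, which vanishes after
  division by \<open>m\<close>.\<close>

lemma window_law_average:
  assumes "window_law W e"
  shows "(\<lambda>m. (\<Sum>k=n..<m. W k) / real m) \<longlonglongrightarrow> e"
proof (rule LIMSEQ_I)
  fix \<epsilon> :: real assume \<epsilon>: "\<epsilon> > 0"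
  obtain K N where KN: "\<And>n m. n \<ge> N \<Longrightarrow> real n + K * ln (real n) \<le> real m \<Longrightarrow>
    \<bar>(\<Sum>k=n..<m. W k) - (real m - real n) * e\<bar> \<le> \<epsilon> / 2 * (real m - real n)"
    using assms \<epsilon> unfolding window_law_def by (meson half_gt_zero)
  define N' where "N' = max n N"
  define c where "c = \<bar>\<Sum>k=n..<N'. W k\<bar> + real N' * \<bar>e\<bar>"
  obtain M where M: "real M > real N' + max (K * ln (real N')) 0" "real M > 2 * c / \<epsilon>"
  proof -
    obtain M where "max (real N' + max (K * ln (real N')) 0) (2 * c / \<epsilon>) < real M"
      using reals_Archimedean2 by blast
    then show thesis by (intro that[of M]) simp_all
  qed
  show "\<exists>no. \<forall>m\<ge>no. norm ((\<Sum>k=n..<m. W k) / real m - e) < \<epsilon>"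
  proof (intro exI[of _ M] allI impI)
    fix m assume m: "M \<le> m"
    have m': "real N' + K * ln (real N') \<le> real m" "N' \<le> m" "0 < m" using m M by linarith+
    have "(\<Sum>k=n..<m. W k) = (\<Sum>k=n..<N'. W k) + (\<Sum>k=N'..<m. W k)"
      using m' by (subst sum.atLeastLessThan_concat) (auto simp: N'_def)
    then have "(\<Sum>k=n..<m. W k) - real m * e =
        (\<Sum>k=n..<N'. W k) - real N' * e + ((\<Sum>k=N'..<m. W k) - (real m - real N') * e)"
      by (simp add: algebra_simps)
    moreover have "\<bar>(\<Sum>k=N'..<m. W k) - (real m - real N') * e\<bar> \<le> \<epsilon> / 2 * (real m - real N')"
      using m' by (intro KN) (auto simp: N'_def)
    moreover have "\<epsilon> / 2 * (real m - real N') \<le> \<epsilon> / 2 * real m"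
      using \<epsilon> by (intro mult_left_mono) auto
    moreover have "\<bar>(\<Sum>k=n..<N'. W k) - real N' * e\<bar> \<le> c"
      unfolding c_def by (rule order_trans[OF abs_triangle_ineq4]) (simp add: abs_mult)
    moreover have "c < \<epsilon> / 2 * real m"
    proof -
      have "2 * c / \<epsilon> < real m" using M(2) m by linarith
      then show ?thesis using \<epsilon> by (simp add: field_simps)
    qed
    ultimately have "\<bar>(\<Sum>k=n..<m. W k) - real m * e\<bar> < \<epsilon> * real m" by linarith
    moreover have "(\<Sum>k=n..<m. W k) / real m - e = ((\<Sum>k=n..<m. W k) - real m * e) / real m"
      using m' by (simp add: field_simps)
    ultimately show "norm ((\<Sum>k=n..<m. W k) / real m - e) < \<epsilon>"
      using m' by (simp add: abs_divide pos_divide_less_eq)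
  qed
qed

text \<open>Division by \<open>m\<close> removes the constant \<open>c\<close> and turns the sums
  into expectations. This is how the sharpness of an exponent is read off.\<close>

lemma window_law_sums_le:
  assumes "window_law V v" "window_law W w"
    and "eventually (\<lambda>m. c + a * (\<Sum>k=n..<m. V k) \<le> b * (\<Sum>k=n..<m. W k)) sequentially"
  shows "a * v \<le> b * w"
proof (rule tendsto_le[OF sequentially_bot])
  show "(\<lambda>m. b * ((\<Sum>k=n..<m. W k) / real m)) \<longlonglongrightarrow> b * w"
    by (intro tendsto_intros window_law_average assms(2))
  have "(\<lambda>m. c / real m + a * ((\<Sum>k=n..<m. V k) / real m)) \<longlonglongrightarrow> 0 + a * v"
    by (intro tendsto_intros window_law_average assms(1) lim_const_over_n)
  then show "(\<lambda>m. c / real m + a * ((\<Sum>k=n..<m. V k) / real m)) \<longlonglongrightarrow> a * v" by simp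
  show "eventually (\<lambda>m. c / real m + a * ((\<Sum>k=n..<m. V k) / real m) \<le> b * ((\<Sum>k=n..<m. W k) / real m)) sequentially"
    using assms(3)
  proof eventually_elim
    case (elim m)
    have "c / real m + a * ((\<Sum>k=n..<m. V k) / real m) = (c + a * (\<Sum>k=n..<m. V k)) / real m"
      by (simp add: add_divide_distrib)
    also have "\<dots> \<le> b * (\<Sum>k=n..<m. W k) / real m"
      using elim by (intro divide_right_mono) auto
    finally show ?case by simp
  qed
qed

text \<open>
  This is the only use of largeness of \<open>\<Phi>\<close>: scales with \<open>r < R powr (1 + \<Phi> R)\<close> are so far
  apart that the generations between them form a window to which the window law applies.
\<close>

lemma large_window:
  assumes "window_law Z z" "\<And>k. 0 \<le> Z k" "0 \<le> z" "large \<Phi>"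
  shows "\<exists>N C. 0 < C \<and> C < 1 \<and> (\<forall>n\<ge>N. \<forall>m r R. 0 < r \<longrightarrow> r < R powr (1 + \<Phi> R) \<longrightarrow> 0 < R \<longrightarrow> R \<le> C \<longrightarrow>
     real n * ln 2 \<le> - ln R \<longrightarrow> ln (R / r) \<le> c + (\<Sum>k=n..<m. Z k) \<longrightarrow> real n + K * ln (real n) \<le> real m)"
proof -
  obtain K\<^sub>0 N where KN: "\<And>K n m. K\<^sub>0 \<le> K \<Longrightarrow> n \<ge> N \<Longrightarrow> real n + K * ln (real n) \<le> real m \<Longrightarrow>
    \<bar>(\<Sum>k=n..<m. Z k) - (real m - real n) * z\<bar> \<le> 1 * (real m - real n)"
    using window_lawD[OF assms(1) zero_less_one] by blast
  define K1 where "K1 = max 0 (max K K\<^sub>0)"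
  \<comment> \<open>Half of \<open>B\<close> bounds \<open>ln (R / r) / ln n\<close> when the window
    is too short; the \<open>2\<close> compensates for the loss in
    \<open>ln n / 2 \<le> ln |ln R|\<close>.\<close>
  define B where "B = 2 * (\<bar>c\<bar> + (z + 1) * (K1 + 1))"
  obtain A \<delta> where A: "filterlim A at_top (at_right 0)" "0 < \<delta>" "\<delta> \<le> 1"
    "\<And>x. 0 < x \<Longrightarrow> x < \<delta> \<Longrightarrow> A x * (ln \<bar>ln x\<bar> / \<bar>ln x\<bar>) \<le> \<Phi> x"
    using assms(4) unfolding large_def by metis
  have "eventually (\<lambda>x. B \<le> A x) (at_right 0)"
    using A(1) by (simp add: filterlim_at_top)
  then obtain b where b: "b > 0" "\<And>x. 0 < x \<Longrightarrow> x < b \<Longrightarrow> B \<le> A x"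
    unfolding eventually_at_right_field by auto
  define C where "C = min (b / 2) (\<delta> / 2)"
  show ?thesis
  proof (intro exI[of _ "max 3 N"] exI[of _ C] conjI allI impI)
    show "0 < C" "C < 1" using b A by (auto simp: C_def)
    fix n m :: nat and r R :: real
    assume n: "max 3 N \<le> n" and r: "0 < r" "r < R powr (1 + \<Phi> R)" and R: "0 < R" "R \<le> C"
      and nR: "real n * ln 2 \<le> - ln R" and rR: "ln (R / r) \<le> c + (\<Sum>k=n..<m. Z k)"
    have ln1: "1 \<le> ln (real n)" using n by (intro one_le_ln) auto
    show "real n + K * ln (real n) \<le> real m"
    proof (rule ccontr)
      assume neg: "\<not> ?thesis"
      have KK: "K * ln (real n) \<le> K1 * ln (real n)"
        using ln1 by (intro mult_right_mono) (auto simp: K1_def)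
      have K1n: "0 \<le> K1 * ln (real n)" using ln1 by (simp add: K1_def)
      \<comment> \<open>A window that is too short is prolonged until the law applies to it. As all
        \<open>Z k\<close> are nonnegative, its sum is then still of order
        \<open>ln n\<close>.\<close>
      define m1 where "m1 = nat \<lceil>real n + K1 * ln (real n)\<rceil>"
      have m1: "real n + K1 * ln (real n) \<le> real m1" "real m1 \<le> real n + K1 * ln (real n) + 1"
        using K1n unfolding m1_def by linarith+
      have "m \<le> m1" using m1 neg KK by linarith
      have "(\<Sum>k=n..<m. Z k) \<le> (\<Sum>k=n..<m1. Z k)"
        using \<open>m \<le> m1\<close> assms(2) by (intro sum_mono2) auto
      also have "\<dots> \<le> (z + 1) * (real m1 - real n)"
      proof -
        have "\<bar>(\<Sum>k=n..<m1. Z k) - (real m1 - real n) * z\<bar> \<le> 1 * (real m1 - real n)"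
          using m1(1) n by (intro KN[of K1]) (auto simp: K1_def)
        then show ?thesis by (simp add: algebra_simps abs_le_iff)
      qed
      also have "\<dots> \<le> (z + 1) * (K1 * ln (real n) + 1)"
        using m1(2) assms(3) by (intro mult_left_mono) auto
      also have "\<dots> \<le> (z + 1) * ((K1 + 1) * ln (real n))"
        using ln1 assms(3) by (intro mult_left_mono) (auto simp: algebra_simps)
      finally have S: "(\<Sum>k=n..<m. Z k) \<le> (z + 1) * (K1 + 1) * ln (real n)" by simp
      have "\<bar>c\<bar> * 1 \<le> \<bar>c\<bar> * ln (real n)" using ln1 by (intro mult_left_mono) auto
      then have up: "ln (R / r) \<le> B / 2 * ln (real n)"
        using S rR by (simp add: B_def algebra_simps)
      have Rlt: "R < \<delta>" "R < b" "R < 1" using R A b by (auto simp: C_def)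
      have lnR: "ln R < 0" using R Rlt by simp
      have "B \<le> A R" using b R Rlt by auto
      have B0: "B \<ge> 0" using assms(3) by (simp add: B_def K1_def)
      have nln2: "0 < real n * ln 2" using n by simp
      \<comment> \<open>This makes \<open>n * ln 2\<close>, a lower bound for \<open>|ln R|\<close>,
        at least \<open>sqrt n\<close>, so \<open>ln |ln R|\<close> is comparable with
        \<open>ln n\<close>.\<close>
      have "1 \<le> real n * (ln 2)\<^sup>2"
      proof -
        have "(2/3)\<^sup>2 \<le> (ln (2::real))\<^sup>2" using ln2_ge_two_thirds by (intro power_mono) auto
        then have "3 * (2/3)\<^sup>2 \<le> real n * (ln 2)\<^sup>2" using n by (intro mult_mono) auto
        then show ?thesis by (simp add: power2_eq_square)
      qed
      then have "0 \<le> ln (real n * (ln 2)\<^sup>2)" by simp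
      also have "\<dots> = 2 * ln (real n * ln 2) - ln (real n)"
        using n by (simp add: ln_mult ln_realpow)
      finally have "ln (real n) / 2 \<le> ln (real n * ln 2)" by simp
      also have "\<dots> \<le> ln \<bar>ln R\<bar>" using nR nln2 lnR by (subst ln_le_cancel_iff) auto
      finally have lnln: "ln (real n) / 2 \<le> ln \<bar>ln R\<bar>" .
      have "B * (ln (real n) / 2) \<le> A R * ln \<bar>ln R\<bar>"
        using lnln B0 ln1 \<open>B \<le> A R\<close> by (intro mult_mono) auto
      also have "\<dots> = A R * (ln \<bar>ln R\<bar> / \<bar>ln R\<bar>) * \<bar>ln R\<bar>" using lnR by simp
      also have "\<dots> \<le> \<Phi> R * \<bar>ln R\<bar>" using A(4)[of R] R Rlt by (intro mult_right_mono) auto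
      \<comment> \<open>The logarithm of \<open>r < R powr (1 + \<Phi> R)\<close>; here
        \<open>ln R < 0\<close>.\<close>
      also have "\<dots> < ln (R / r)"
      proof -
        have "ln r < ln (R powr (1 + \<Phi> R))" using r R by (subst ln_less_cancel_iff) auto
        then show ?thesis using r R lnR by (simp add: ln_powr ln_div algebra_simps)
      qed
      finally show False using up by simp
    qed
  qed
qed

lemma powr_1_plus_le:
  assumes "dimension_function \<Phi>" "0 < R" "R < 1"
  shows "R powr (1 + \<Phi> R) \<le> R"
proof -
  have "R powr (1 + \<Phi> R) \<le> R powr 1"
    using assms by (intro powr_mono') (auto simp: dimension_function_def)
  then show ?thesis using assms by simp
qed

context moran_tree
begin

section \<open>From scales to generations\<close>

abbreviation SX :: "nat \<Rightarrow> nat \<Rightarrow> real" where "SX n m \<equiv> \<Sum>k=n..<m. X_val (\<omega> k)"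
abbreviation SY :: "nat \<Rightarrow> nat \<Rightarrow> real" where "SY n m \<equiv> \<Sum>k=n..<m. Y_val (\<omega> k)"
abbreviation SZ :: "nat \<Rightarrow> nat \<Rightarrow> real" where "SZ n m \<equiv> \<Sum>k=n..<m. Z_val (\<omega> k)"

lemma Z_nonneg: "0 \<le> Z_val (\<omega> k)"
  using ratio_pos[of k] ratio_le[of k] by (simp add: Z_val_def)

lemma Y_nonneg: "0 \<le> Y_val (\<omega> k)"
proof -
  have 0: "0 < num_children (\<omega> k)" using num_children_ge[of k] by simp
  have "weight (\<omega> k) 0 \<le> (\<Sum>j<num_children (\<omega> k). weight (\<omega> k) j)"
    using 0 by (intro member_le_sum) (auto intro: less_imp_le weight_pos)
  then have "weight (\<omega> k) 0 \<le> 1" using \<omega>[of k] by (simp add: Omega0_def)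
  then have "1 \<le> 1 / weight (\<omega> k) 0" using weight_pos[OF 0] by simp
  also have "\<dots> \<le> exp (Y_val (\<omega> k))" using Y_ge[OF 0] .
  finally show ?thesis by simp
qed

lemma ln_D_diff: "n \<le> m \<Longrightarrow> ln (D n) - ln (D m) = SZ n m"
  using D_eq_exp[of n m] D_pos[of m] by (simp add: ln_mult)

text \<open>For \<open>m < n\<close> the sum is empty and the left side is not positive. The order
  of \<open>n\<close> and \<open>m\<close> is still unknown where this is used, before
  \<open>large_window\<close> has been applied.\<close>

lemma ln_D_diff_le: "ln (D n) - ln (D m) \<le> SZ n m"
proof (cases "n \<le> m")
  case False
  then show ?thesis using D_antimono[of m n] D_pos[of n] D_pos[of m] by simp
qed (simp add: ln_D_diff)

text \<open>The predecessor of the least \<open>k\<close> with \<open>a * D k < s\<close>. The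
  values \<open>a = 1\<close> and \<open>a = \<tau>\<close> serve balls that are compared with
  pieces from outside or from inside; \<open>N\<close> puts the generation in the range of the
  window laws.\<close>

lemma generation_of_scale:
  assumes "0 < s" "0 < a" "s \<le> a * D N"
  obtains n where "N \<le> n" "s \<le> a * D n" "a * D (Suc n) < s"
proof -
  have "eventually (\<lambda>k. D k < s / a) sequentially"
    using assms by (intro order_tendstoD(2)[OF D_tendsto_0]) auto
  then have "\<exists>k. a * D k < s"
    using assms by (auto simp: eventually_sequentially field_simps)
  define k where "k = (LEAST k. a * D k < s)"
  have k: "a * D k < s" unfolding k_def by (rule LeastI_ex) fact
  have "N < k"
  proof (rule ccontr)
    assume "\<not> N < k"
    then have "a * D N \<le> a * D k" using assms by (intro mult_left_mono D_antimono) auto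
    with k assms show False by simp
  qed
  then obtain n where n: "k = Suc n" "N \<le> n" by (cases k) auto
  have "\<not> a * D n < s" using not_less_Least[of n "\<lambda>k. a * D k < s"] n by (simp add: k_def)
  with that[of n] n k show thesis by simp
qed

lemma scale_le_exp:
  assumes "0 < R" "R \<le> D n" shows "real n * ln 2 \<le> - ln R"
proof -
  have "R \<le> exp (- (real n * ln 2))" using D_le_exp[of n] assms by simp
  then have "ln R \<le> ln (exp (- (real n * ln 2)))" using assms(1) by (subst ln_le_cancel_iff) auto
  then show ?thesis by simp
qed

definition lower_exponent :: "(real \<Rightarrow> real) \<Rightarrow> real \<Rightarrow> bool" where
  "lower_exponent \<Phi> d \<longleftrightarrow> (\<exists>C1 C2. 0 < C1 \<and> C1 < 1 \<and> 0 < C2 \<and>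
     (\<forall>r R. 0 < r \<and> r < R powr (1 + \<Phi> R) \<and> R powr (1 + \<Phi> R) \<le> R \<and> 0 < R \<and> R \<le> C1 \<longrightarrow>
        (\<forall>x\<in>measure_support M.
           C2 * (R / r) powr d \<le> measure M (ball x R) / measure M (ball x r))))"

definition upper_exponent :: "(real \<Rightarrow> real) \<Rightarrow> real \<Rightarrow> bool" where
  "upper_exponent \<Phi> d \<longleftrightarrow> (\<exists>C1 C2. 0 < C1 \<and> C1 < 1 \<and> 0 < C2 \<and>
     (\<forall>r R. 0 < r \<and> r < R powr (1 + \<Phi> R) \<and> R powr (1 + \<Phi> R) \<le> R \<and> 0 < R \<and> R \<le> C1 \<longrightarrow>
        (\<forall>x\<in>measure_support M.
           measure M (ball x R) / measure M (ball x r) \<le> C2 * (R / r) powr d)))"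

text \<open>Mass quotients are at least \<open>1\<close>, and so are scale quotients. The case is
  separate because the window argument multiplies inequalities by \<open>d \<ge> 0\<close>.\<close>

lemma lower_exponent_neg:
  assumes "d < 0" shows "lower_exponent \<Phi> d"
  unfolding lower_exponent_def
proof (rule exI[of _ "1/2"], rule exI[of _ 1], intro conjI allI impI ballI)
  fix r R x assume "0 < r \<and> r < R powr (1 + \<Phi> R) \<and> R powr (1 + \<Phi> R) \<le> R \<and> 0 < R \<and> R \<le> 1/2"
    and "x \<in> measure_support M"
  then have *: "0 < r" "r < R powr (1 + \<Phi> R)" "R powr (1 + \<Phi> R) \<le> R" "x \<in> measure_support M"
    by blast+
  have "(R / r) powr d \<le> (R / r) powr 0"
    using * assms by (intro powr_mono) auto
  also have "\<dots> = 1" using * by simp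
  also have "\<dots> \<le> measure M (ball x R) / measure M (ball x r)"
    using measure_ball_pos[OF *(4,1)] * by (auto intro!: finite_measure_mono)
  finally show "1 * (R / r) powr d \<le> measure M (ball x R) / measure M (ball x r)" by simp
qed auto

text \<open>The scale quotient is bounded above by the long window of \<open>Z\<close>, from
  \<open>n\<close> to \<open>m\<close>, and the mass quotient below by the short window of
  \<open>X\<close>, from \<open>n + 1\<close> to \<open>m - 1\<close>.\<close>

lemma lower_exponent_if_less:
  assumes Z: "window_law (\<lambda>k. Z_val (\<omega> k)) z" and X: "window_law (\<lambda>k. X_val (\<omega> k)) x"
    and z: "0 < z" and "large \<Phi>" and d: "0 \<le> d" "d * z < x"
  shows "lower_exponent \<Phi> d"
proof -
  \<comment> \<open>The solution of \<open>d * (z + \<epsilon>) = x - \<epsilon>\<close>: both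
    deviations together just use up the gap between \<open>d * z\<close> and
    \<open>x\<close>.\<close>
  define \<epsilon> where "\<epsilon> = (x - d * z) / (d + 1)"
  have \<epsilon>: "\<epsilon> > 0" "d * (z + \<epsilon>) = x - \<epsilon>" using d by (auto simp: \<epsilon>_def field_simps)
  obtain KZ NZ where KZ: "\<And>K n m. KZ \<le> K \<Longrightarrow> NZ \<le> n \<Longrightarrow> real n + K * ln (real n) \<le> real m \<Longrightarrow>
      \<bar>SZ n m - (real m - real n) * z\<bar> \<le> \<epsilon> * (real m - real n)"
    using window_lawD[OF Z \<epsilon>(1)] by blast
  obtain KX NX where KX: "\<And>K n m. KX \<le> K \<Longrightarrow> NX \<le> n \<Longrightarrow> real n + K * ln (real n) \<le> real m \<Longrightarrow>
      Suc n < m \<and> \<bar>SX (Suc n) (m - 1) - (real m - real n - 2) * x\<bar> \<le> \<epsilon> * (real m - real n - 2)"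
    using window_law_shrunkD[OF X \<epsilon>(1)] by blast
  define K where "K = max KZ KX"
  obtain N0 C where C: "0 < C" "C < 1" and
    win: "\<And>n m r R. N0 \<le> n \<Longrightarrow> 0 < r \<Longrightarrow> r < R powr (1 + \<Phi> R) \<Longrightarrow> 0 < R \<Longrightarrow> R \<le> C \<Longrightarrow>
     real n * ln 2 \<le> - ln R \<Longrightarrow> ln (R / r) \<le> - ln \<tau> + SZ n m \<Longrightarrow> real n + K * ln (real n) \<le> real m"
    using large_window[OF Z Z_nonneg less_imp_le[OF z] \<open>large \<Phi>\<close>, of "- ln \<tau>" K] by blast
  define N where "N = max N0 (max NZ NX)"
  show ?thesis
    unfolding lower_exponent_def
  \<comment> \<open>\<open>D N\<close> forces \<open>n \<ge> N\<close>, and \<open>\<tau>\<close>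
    ensures that \<open>r\<close> has a generation \<open>m\<close>. \<open>C2\<close> pays for the
    factor \<open>\<tau>\<close> and for the two generations by which the windows differ.\<close>
  proof (rule exI[of _ "min C (min (D N) \<tau>)"], rule exI[of _ "exp (d * ln \<tau> - 2 * d * (z + \<epsilon>))"],
      intro conjI allI impI ballI)
    show "0 < min C (min (D N) \<tau>)" "min C (min (D N) \<tau>) < 1" using C \<tau> D_pos by auto
    fix r R y assume "0 < r \<and> r < R powr (1 + \<Phi> R) \<and> R powr (1 + \<Phi> R) \<le> R \<and> 0 < R \<and> R \<le> min C (min (D N) \<tau>)"
      and y: "y \<in> measure_support M"
    then have r: "0 < r" "r < R powr (1 + \<Phi> R)" "R powr (1 + \<Phi> R) \<le> R"
      and R: "0 < R" "R \<le> min C (min (D N) \<tau>)" by blast+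
    obtain n where n: "N \<le> n" "R \<le> D n" "D (Suc n) < R"
      using generation_of_scale[of R 1 N] R by auto
    obtain m where m: "r \<le> \<tau> * D m" "\<tau> * D (Suc m) < r"
      using generation_of_scale[of r \<tau> 0] r R \<tau> by auto
    have "ln (R / r) = ln R - ln r" using r R by (simp add: ln_div)
    also have "\<dots> \<le> ln (D n) - ln (\<tau> * D (Suc m))"
      using n m r R \<tau> D_pos by (intro diff_mono) (auto intro: ln_mono)
    also have "\<dots> = - ln \<tau> + (ln (D n) - ln (D (Suc m)))"
      using \<tau> D_pos[of "Suc m"] by (simp add: ln_mult)
    also have "\<dots> \<le> - ln \<tau> + SZ n (Suc m)" by (intro add_left_mono ln_D_diff_le)
    finally have Rr: "ln (R / r) \<le> - ln \<tau> + SZ n (Suc m)" .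
    have long: "real n + K * ln (real n) \<le> real (Suc m)"
      using n r R Rr scale_le_exp[of R n] by (intro win[of n r R]) (auto simp: N_def)
    define L where "L = real (Suc m) - real n - 2"
    have L: "real (Suc m) - real n = L + 2" by (simp add: L_def)
    have "\<bar>SZ n (Suc m) - (L + 2) * z\<bar> \<le> \<epsilon> * (L + 2)"
      using KZ[OF _ _ long] n unfolding L by (simp add: N_def K_def del: sum.op_ivl_Suc)
    then have "SZ n (Suc m) \<le> (z + \<epsilon>) * (L + 2)" by (simp add: algebra_simps abs_le_iff del: sum.op_ivl_Suc)
    then have "d * ln (R / r) \<le> d * (- ln \<tau> + (z + \<epsilon>) * (L + 2))"
      using Rr d by (intro mult_left_mono) auto
    also have "\<dots> = (d * (z + \<epsilon>)) * L - (d * ln \<tau> - 2 * d * (z + \<epsilon>))" by (simp add: algebra_simps)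
    finally have 1: "(d * ln \<tau> - 2 * d * (z + \<epsilon>)) + d * ln (R / r) \<le> (x - \<epsilon>) * L"
      using \<epsilon>(2) by simp
    have nm: "Suc n \<le> m" and "\<bar>SX (Suc n) m - L * x\<bar> \<le> \<epsilon> * L"
      using KX[of K n "Suc m"] long n by (simp_all add: N_def K_def L_def)
    then have 2: "(x - \<epsilon>) * L \<le> SX (Suc n) m" by (simp add: algebra_simps abs_le_iff del: sum.op_ivl_Suc)
    have "exp (d * ln \<tau> - 2 * d * (z + \<epsilon>)) * (R / r) powr d =
        exp ((d * ln \<tau> - 2 * d * (z + \<epsilon>)) + d * ln (R / r))"
      using r R by (simp add: powr_def exp_add)
    also have "\<dots> \<le> exp (SX (Suc n) m)" using 1 2 by simp
    also have "\<dots> \<le> measure M (ball y R) / measure M (ball y r)"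
      using ball_ratio_ge[OF y nm n(3) m(1) r(1)] .
    finally show "exp (d * ln \<tau> - 2 * d * (z + \<epsilon>)) * (R / r) powr d
        \<le> measure M (ball y R) / measure M (ball y r)" .
  qed auto
qed

text \<open>With \<open>R\<close> fixed, all sufficiently small \<open>r\<close> are admissible, so
  averages over windows with a fixed start decide.\<close>

lemma lower_exponent_le:
  assumes Z: "window_law (\<lambda>k. Z_val (\<omega> k)) z" and X: "window_law (\<lambda>k. X_val (\<omega> k)) x"
    and \<Phi>: "dimension_function \<Phi>" and "lower_exponent \<Phi> d"
  shows "d * z \<le> x"
proof -
  obtain C1 C2 where C: "0 < C1" "C1 < 1" "0 < C2" and
    bd: "\<And>r R y. 0 < r \<Longrightarrow> r < R powr (1 + \<Phi> R) \<Longrightarrow> R powr (1 + \<Phi> R) \<le> R \<Longrightarrow> 0 < R \<Longrightarrow> R \<le> C1 \<Longrightarrow>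
        y \<in> measure_support M \<Longrightarrow> C2 * (R / r) powr d \<le> measure M (ball y R) / measure M (ball y r)"
    using assms(4) unfolding lower_exponent_def by metis
  obtain y where y: "y \<in> measure_support M" and
    heavy: "\<And>n m R r. n \<le> m \<Longrightarrow> R \<le> \<tau> * D n \<Longrightarrow> D m < r \<Longrightarrow>
     measure M (ball y R) / measure M (ball y r) \<le> exp (SX n m)"
    using heavy_point by metis
  obtain n where n: "D n < C1"
    using order_tendstoD(2)[OF D_tendsto_0 C(1)] by (auto simp: eventually_sequentially)
  \<comment> \<open>The ball of radius \<open>\<tau> * D n\<close> stays within one piece of step
    \<open>n\<close> up to a null set. It is paired with \<open>r = 2 * D m\<close>, where the
    \<open>2\<close> supplies the strict inequality \<open>D m < r\<close>.\<close>
  define R where "R = \<tau> * D n"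
  have R: "0 < R" "R \<le> C1" "R < 1"
  proof -
    have "R \<le> 1 * D n" unfolding R_def using \<tau> D_pos[of n] by (intro mult_right_mono) auto
    then show "R \<le> C1" "R < 1" using n C by linarith+
    show "0 < R" using \<tau> D_pos[of n] by (simp add: R_def)
  qed
  define c where "c = ln C2 + d * (ln \<tau> - ln 2)"
  have "eventually (\<lambda>m. D m < R powr (1 + \<Phi> R) / 2) sequentially"
    using R by (intro order_tendstoD(2)[OF D_tendsto_0]) auto
  then have "eventually (\<lambda>m. c + d * SZ n m \<le> 1 * SX n m) sequentially"
    using eventually_ge_at_top[of n]
  proof eventually_elim
    case (elim m)
    have "C2 * (R / (2 * D m)) powr d \<le> measure M (ball y R) / measure M (ball y (2 * D m))"
      using elim R D_pos[of m] powr_1_plus_le[OF \<Phi> R(1,3)] by (intro bd y) auto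
    also have "\<dots> \<le> exp (SX n m)"
      using elim D_pos[of m] by (intro heavy) (auto simp: R_def)
    finally have "ln (C2 * (R / (2 * D m)) powr d) \<le> ln (exp (SX n m))"
      using C R D_pos[of m] by (subst ln_le_cancel_iff) auto
    moreover have "ln (C2 * (R / (2 * D m)) powr d) = c + d * SZ n m"
      using C \<tau> D_pos[of m] D_pos[of n] R elim
      by (simp add: ln_mult ln_div ln_powr R_def c_def ln_D_diff[symmetric] algebra_simps)
    ultimately show ?case by simp
  qed
  then have "d * z \<le> 1 * x" by (rule window_law_sums_le[OF Z X])
  then show ?thesis by simp
qed

lemma lower_Phi_dim_eq:
  assumes Z: "window_law (\<lambda>k. Z_val (\<omega> k)) z" and X: "window_law (\<lambda>k. X_val (\<omega> k)) x"
    and z: "0 < z" and \<Phi>: "dimension_function \<Phi>" "large \<Phi>"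
  shows "lower_Phi_dim \<Phi> M = ereal (x / z)"
proof -
  have eq: "lower_Phi_dim \<Phi> M = Sup {ereal d | d. lower_exponent \<Phi> d}"
    unfolding lower_Phi_dim_def lower_exponent_def ..
  show ?thesis
    unfolding eq
  proof (rule antisym)
    show "Sup {ereal d | d. lower_exponent \<Phi> d} \<le> ereal (x / z)"
      using lower_exponent_le[OF Z X \<Phi>(1)] z by (auto intro!: Sup_least simp: pos_le_divide_eq)
    show "ereal (x / z) \<le> Sup {ereal d | d. lower_exponent \<Phi> d}"
    proof (rule dense_le)
      fix e assume e: "e < ereal (x / z)"
      show "e \<le> Sup {ereal d | d. lower_exponent \<Phi> d}"
      proof (cases e)
        case (real d)
        then have "d * z < x" using e z by (simp add: pos_less_divide_eq)
        then have "lower_exponent \<Phi> d"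
          using lower_exponent_neg lower_exponent_if_less[OF Z X z \<Phi>(2)] by (cases "d < 0") auto
        then show ?thesis using real by (auto intro: Sup_upper)
      qed (use e in auto)
    qed
  qed
qed

text \<open>The windows change roles: the mass quotient is bounded above by the long window of
  \<open>Y\<close>, the scale quotient below by the short window of \<open>Z\<close>.\<close>

lemma upper_exponent_if_greater:
  assumes Z: "window_law (\<lambda>k. Z_val (\<omega> k)) z" and Y: "window_law (\<lambda>k. Y_val (\<omega> k)) y"
    and z: "0 < z" and "large \<Phi>" and d: "0 \<le> d" "y < d * z"
  shows "upper_exponent \<Phi> d"
proof -
  \<comment> \<open>The solution of \<open>d * (z - \<epsilon>) = y + \<epsilon>\<close>.\<close>
  define \<epsilon> where "\<epsilon> = (d * z - y) / (d + 1)"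
  have \<epsilon>: "\<epsilon> > 0" "d * (z - \<epsilon>) = y + \<epsilon>" using d by (auto simp: \<epsilon>_def field_simps)
  obtain KY NY where KY: "\<And>K n m. KY \<le> K \<Longrightarrow> NY \<le> n \<Longrightarrow> real n + K * ln (real n) \<le> real m \<Longrightarrow>
      \<bar>SY n m - (real m - real n) * y\<bar> \<le> \<epsilon> * (real m - real n)"
    using window_lawD[OF Y \<epsilon>(1)] by blast
  obtain KZ NZ where KZ: "\<And>K n m. KZ \<le> K \<Longrightarrow> NZ \<le> n \<Longrightarrow> real n + K * ln (real n) \<le> real m \<Longrightarrow>
      Suc n < m \<and> \<bar>SZ (Suc n) (m - 1) - (real m - real n - 2) * z\<bar> \<le> \<epsilon> * (real m - real n - 2)"
    using window_law_shrunkD[OF Z \<epsilon>(1)] by blast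
  define K where "K = max KZ KY"
  obtain N0 C where C: "0 < C" "C < 1" and
    win: "\<And>n m r R. N0 \<le> n \<Longrightarrow> 0 < r \<Longrightarrow> r < R powr (1 + \<Phi> R) \<Longrightarrow> 0 < R \<Longrightarrow> R \<le> C \<Longrightarrow>
     real n * ln 2 \<le> - ln R \<Longrightarrow> ln (R / r) \<le> 0 + SZ n m \<Longrightarrow> real n + K * ln (real n) \<le> real m"
    using large_window[OF Z Z_nonneg less_imp_le[OF z] \<open>large \<Phi>\<close>, of 0 K] by blast
  define N where "N = max N0 (max NZ NY)"
  show ?thesis
    unfolding upper_exponent_def
  \<comment> \<open>\<open>2 * d * (z - \<epsilon>)\<close> equals
    \<open>2 * (y + \<epsilon>)\<close>, the share of the two generations that only the window of
    \<open>Y\<close> contains; \<open>d * ln \<tau>\<close> is the loss in scale.\<close>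
  proof (rule exI[of _ "min C (\<tau> * D N)"], rule exI[of _ "exp (2 * d * (z - \<epsilon>) - d * ln \<tau>)"],
      intro conjI allI impI ballI)
    show "0 < min C (\<tau> * D N)" "min C (\<tau> * D N) < 1" using C \<tau> D_pos by auto
    fix r R u assume "0 < r \<and> r < R powr (1 + \<Phi> R) \<and> R powr (1 + \<Phi> R) \<le> R \<and> 0 < R \<and> R \<le> min C (\<tau> * D N)"
      and u: "u \<in> measure_support M"
    then have r: "0 < r" "r < R powr (1 + \<Phi> R)" "R powr (1 + \<Phi> R) \<le> R"
      and R: "0 < R" "R \<le> min C (\<tau> * D N)" by blast+
    obtain n where n: "N \<le> n" "R \<le> \<tau> * D n" "\<tau> * D (Suc n) < R"
      using generation_of_scale[of R \<tau> N] R \<tau> by auto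
    obtain m where m: "r \<le> D m" "D (Suc m) < r"
      using generation_of_scale[of r 1 0] r R C by auto
    have RD: "R \<le> D n" using n(2) \<tau> D_pos[of n] by (smt (verit) mult_left_le_one_le)
    have "ln (R / r) = ln R - ln r" using r R by (simp add: ln_div)
    also have "\<dots> \<le> ln (D n) - ln (D (Suc m))"
      using RD m r R D_pos by (intro diff_mono) (auto intro: ln_mono)
    also have "\<dots> \<le> SZ n (Suc m)" by (rule ln_D_diff_le)
    finally have Rr: "ln (R / r) \<le> 0 + SZ n (Suc m)" by simp
    have long: "real n + K * ln (real n) \<le> real (Suc m)"
      using n r R Rr scale_le_exp[OF R(1) RD] by (intro win[of n r R]) (auto simp: N_def)
    define L where "L = real (Suc m) - real n - 2"
    have L: "real (Suc m) - real n = L + 2" by (simp add: L_def)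
    have "\<bar>SY n (Suc m) - (L + 2) * y\<bar> \<le> \<epsilon> * (L + 2)"
      using KY[OF _ _ long] n unfolding L by (simp add: N_def K_def del: sum.op_ivl_Suc)
    then have 1: "SY n (Suc m) \<le> (y + \<epsilon>) * (L + 2)" by (simp add: algebra_simps abs_le_iff del: sum.op_ivl_Suc)
    have nm: "Suc n \<le> m" and "\<bar>SZ (Suc n) m - L * z\<bar> \<le> \<epsilon> * L"
      using KZ[of K n "Suc m"] long n by (simp_all add: N_def K_def L_def)
    then have "ln \<tau> + (z - \<epsilon>) * L \<le> ln \<tau> + SZ (Suc n) m" by (simp add: algebra_simps abs_le_iff del: sum.op_ivl_Suc)
    also have "\<dots> = ln (\<tau> * D (Suc n)) - ln (D m)"
      using ln_D_diff[OF nm] \<tau> D_pos[of "Suc n"] by (simp add: ln_mult)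
    also have "\<dots> \<le> ln R - ln r"
      using n m r R \<tau> D_pos by (intro diff_mono) (auto intro: ln_mono)
    also have "\<dots> = ln (R / r)" using r R by (simp add: ln_div)
    finally have "d * (ln \<tau> + (z - \<epsilon>) * L) \<le> d * ln (R / r)" using d by (intro mult_left_mono)
    then have 2: "d * ln \<tau> + (d * (z - \<epsilon>)) * L \<le> d * ln (R / r)" by (simp add: algebra_simps)
    have "measure M (ball u R) / measure M (ball u r) \<le> exp (SY n (Suc m))"
      using nm by (intro ball_ratio_le[OF u _ n(2) m(2)]) simp
    also have "\<dots> \<le> exp ((2 * d * (z - \<epsilon>) - d * ln \<tau>) + d * ln (R / r))"
      using 1 2 unfolding \<epsilon>(2)[symmetric] by (simp add: algebra_simps)
    also have "\<dots> = exp (2 * d * (z - \<epsilon>) - d * ln \<tau>) * (R / r) powr d"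
      using r R by (simp add: powr_def exp_add)
    finally show "measure M (ball u R) / measure M (ball u r)
        \<le> exp (2 * d * (z - \<epsilon>) - d * ln \<tau>) * (R / r) powr d" .
  qed auto
qed

lemma upper_exponent_ge:
  assumes Z: "window_law (\<lambda>k. Z_val (\<omega> k)) z" and Y: "window_law (\<lambda>k. Y_val (\<omega> k)) y"
    and \<Phi>: "dimension_function \<Phi>" and "upper_exponent \<Phi> d"
  shows "y \<le> d * z"
proof -
  obtain C1 C2 where C: "0 < C1" "C1 < 1" "0 < C2" and
    bd: "\<And>r R u. 0 < r \<Longrightarrow> r < R powr (1 + \<Phi> R) \<Longrightarrow> R powr (1 + \<Phi> R) \<le> R \<Longrightarrow> 0 < R \<Longrightarrow> R \<le> C1 \<Longrightarrow>
        u \<in> measure_support M \<Longrightarrow> measure M (ball u R) / measure M (ball u r) \<le> C2 * (R / r) powr d"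
    using assms(4) unfolding upper_exponent_def by metis
  obtain u where u: "u \<in> measure_support M" and
    light: "\<And>n m R r. n \<le> m \<Longrightarrow> D n < R \<Longrightarrow> 0 < r \<Longrightarrow> r \<le> \<tau> * D m \<Longrightarrow>
     exp (SY n m) \<le> measure M (ball u R) / measure M (ball u r)"
    using light_point by metis
  obtain n where n: "D n < C1 / 2"
    using order_tendstoD(2)[OF D_tendsto_0, of "C1 / 2"] C(1) by (auto simp: eventually_sequentially)
  \<comment> \<open>Now the large ball must contain a piece, whence the \<open>2\<close>, and the
    small one, of radius \<open>\<tau> * D m\<close>, must stay within a piece up to a null
    set.\<close>
  define R where "R = 2 * D n"
  have R: "0 < R" "R \<le> C1" "R < 1" using n C D_pos[of n] by (auto simp: R_def)
  define c where "c = - ln C2 - d * (ln 2 - ln \<tau>)"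
  have "eventually (\<lambda>m. D m < R powr (1 + \<Phi> R)) sequentially"
    using R by (intro order_tendstoD(2)[OF D_tendsto_0]) auto
  then have "eventually (\<lambda>m. c + 1 * SY n m \<le> d * SZ n m) sequentially"
    using eventually_ge_at_top[of n]
  proof eventually_elim
    case (elim m)
    have "\<tau> * D m < R powr (1 + \<Phi> R)"
      using elim(1) \<tau> D_pos[of m] by (smt (verit) mult_left_le_one_le)
    then have "measure M (ball u R) / measure M (ball u (\<tau> * D m)) \<le> C2 * (R / (\<tau> * D m)) powr d"
      using \<tau> R D_pos[of m] powr_1_plus_le[OF \<Phi> R(1,3)] by (intro bd u) auto
    moreover have "exp (SY n m) \<le> measure M (ball u R) / measure M (ball u (\<tau> * D m))"
      using elim \<tau> D_pos[of m] D_pos[of n] by (intro light) (auto simp: R_def)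
    ultimately have "exp (SY n m) \<le> C2 * (R / (\<tau> * D m)) powr d" by linarith
    then have "ln (exp (SY n m)) \<le> ln (C2 * (R / (\<tau> * D m)) powr d)"
      using C R \<tau> D_pos[of m] by (subst ln_le_cancel_iff) auto
    moreover have "ln (C2 * (R / (\<tau> * D m)) powr d) = d * SZ n m - c"
      using C \<tau> D_pos[of m] D_pos[of n] R elim
      by (simp add: ln_mult ln_div ln_powr R_def c_def ln_D_diff[symmetric] algebra_simps)
    ultimately show ?case by simp
  qed
  then have "1 * y \<le> d * z" by (rule window_law_sums_le[OF Y Z])
  then show ?thesis by simp
qed

lemma upper_Phi_dim_eq:
  assumes Z: "window_law (\<lambda>k. Z_val (\<omega> k)) z" and Y: "window_law (\<lambda>k. Y_val (\<omega> k)) y"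
    and z: "0 < z" and \<Phi>: "dimension_function \<Phi>" "large \<Phi>"
  shows "upper_Phi_dim \<Phi> M = ereal (y / z)"
proof -
  \<comment> \<open>This makes every \<open>d > y / z\<close> nonnegative, as
    \<open>upper_exponent_if_greater\<close> requires.\<close>
  have y: "0 \<le> y"
    using window_law_average[OF Y, of 0]
    by (rule LIMSEQ_le_const) (auto intro!: sum_nonneg divide_nonneg_nonneg Y_nonneg)
  have eq: "upper_Phi_dim \<Phi> M = Inf {ereal d | d. upper_exponent \<Phi> d}"
    unfolding upper_Phi_dim_def upper_exponent_def ..
  show ?thesis
    unfolding eq
  proof (rule antisym)
    show "ereal (y / z) \<le> Inf {ereal d | d. upper_exponent \<Phi> d}"
      using upper_exponent_ge[OF Z Y \<Phi>(1)] z by (auto intro!: Inf_greatest simp: pos_divide_le_eq)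
    show "Inf {ereal d | d. upper_exponent \<Phi> d} \<le> ereal (y / z)"
    proof (rule dense_ge)
      fix e assume e: "ereal (y / z) < e"
      show "Inf {ereal d | d. upper_exponent \<Phi> d} \<le> e"
      proof (cases e)
        case (real d)
        then have d: "y / z < d" using e by simp
        then have "y < d * z" using z by (simp add: pos_divide_less_eq)
        moreover have "0 \<le> d" using d y z by (smt (verit) divide_nonneg_pos)
        ultimately have "upper_exponent \<Phi> d"
          using upper_exponent_if_greater[OF Z Y z \<Phi>(2)] by simp
        then show ?thesis using real by (auto intro: Inf_lower)
      qed (use e in auto)
    qed
  qed
qed

end

section \<open>Almost sure window laws\<close>

text \<open>The \<open>\<sigma>\<close>-algebra is the Borel one of the topology on triples, so
  measurability comes from continuity of the coordinates, and for \<open>num_children\<close> from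
  preimages of closed singletons.\<close>

lemma measurable_step_coordinates [measurable]:
  "num_children \<in> measurable borel (count_space UNIV)"
  "ratio \<in> borel_measurable borel"
  "(\<lambda>x. weight x j) \<in> borel_measurable borel"
proof -
  have "num_children -` {t} \<in> sets borel" for t
    unfolding num_children_def[abs_def]
    by (intro borel_closed continuous_closed_vimage) (auto intro!: continuous_intros)
  then show "num_children \<in> measurable borel (count_space UNIV)"
    by (simp add: measurable_count_space_eq2_countable)
  have "continuous_on UNIV (\<lambda>x :: step. fst (snd x))" by (intro continuous_intros)
  then show "ratio \<in> borel_measurable borel"
    unfolding ratio_def[abs_def] by (rule borel_measurable_continuous_onI)
  have "continuous_on UNIV (\<lambda>x :: step. snd (snd x))" by (intro continuous_intros)
  then have "continuous_on UNIV (\<lambda>x :: step. snd (snd x) j)"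
    by (rule continuous_on_product_then_coordinatewise)
  then show "(\<lambda>x. weight x j) \<in> borel_measurable borel"
    unfolding weight_def[abs_def] by (rule borel_measurable_continuous_onI)
qed

text \<open>The index range of \<open>Max\<close> and \<open>Min\<close> varies with the point; it
  is frozen for each of the countably many values of \<open>num_children\<close>.\<close>

lemma measurable_step_values [measurable]:
  "X_val \<in> borel_measurable borel" "Y_val \<in> borel_measurable borel" "Z_val \<in> borel_measurable borel"
proof -
  have "(\<lambda>x. (\<lambda>t x. Max (weight x ` {..<t})) (num_children x) x) \<in> borel_measurable borel"
    by (rule measurable_compose_countable) measurable
  then show "X_val \<in> borel_measurable borel" unfolding X_val_def[abs_def] by simp
  have "(\<lambda>x. (\<lambda>t x. Min (weight x ` {..<t})) (num_children x) x) \<in> borel_measurable borel"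
    by (rule measurable_compose_countable) measurable
  then show "Y_val \<in> borel_measurable borel" unfolding Y_val_def[abs_def] by simp
  show "Z_val \<in> borel_measurable borel" unfolding Z_val_def[abs_def] by measurable
qed

lemma distr_coordinate: "prob_space \<pi> \<Longrightarrow> distr (seq_prob \<pi>) \<pi> (\<lambda>\<omega>. \<omega> n) = \<pi>"
  unfolding seq_prob_def by (rule distr_PiM_component) auto

lemma measurable_coordinate [measurable]: "(\<lambda>\<omega>. \<omega> n) \<in> measurable (seq_prob \<pi>) \<pi>"
  unfolding seq_prob_def by (rule measurable_component_singleton) simp

lemma integral_coordinate:
  fixes W :: "step \<Rightarrow> real"
  assumes "prob_space \<pi>" "W \<in> borel_measurable \<pi>"
  shows "(\<integral>\<omega>. W (\<omega> n) \<partial>seq_prob \<pi>) = (\<integral>x. W x \<partial>\<pi>)"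
  using integral_distr[OF measurable_coordinate assms(2), of n] distr_coordinate[OF assms(1), of n]
  by simp

text \<open>The moments at \<open>A\<close> and \<open>- A\<close> together dominate the exponential
  of \<open>A * |W|\<close>, and a coordinate of the sequence has law \<open>\<pi>\<close>.\<close>

lemma finite_exp_moments_coordinate:
  assumes "prob_space \<pi>" and [measurable]: "W \<in> borel_measurable \<pi>"
    and "finite_exp_moments (seq_prob \<pi>) (\<lambda>\<omega>. W (\<omega> 0))"
  shows "\<exists>A>0. integrable \<pi> (\<lambda>x. exp (A * \<bar>W x\<bar>))"
proof -
  obtain A where A: "A > 0"
    "\<And>s. \<bar>s\<bar> \<le> A \<Longrightarrow> (\<integral>\<^sup>+ \<omega>. ennreal (exp (s * W (\<omega> 0))) \<partial>seq_prob \<pi>) < \<infinity>"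
    using assms(3) unfolding finite_exp_moments_def by blast
  have int: "integrable \<pi> (\<lambda>x. exp (s * W x))" if "\<bar>s\<bar> \<le> A" for s
  proof (rule integrableI_bounded)
    have "(\<integral>\<^sup>+ x. ennreal (exp (s * W x)) \<partial>distr (seq_prob \<pi>) \<pi> (\<lambda>\<omega>. \<omega> 0)) < \<infinity>"
      using A(2)[OF that] by (subst nn_integral_distr) auto
    then show "(\<integral>\<^sup>+ x. ennreal (norm (exp (s * W x))) \<partial>\<pi>) < \<infinity>" by (simp add: distr_coordinate[OF assms(1)])
  qed measurable
  have "integrable \<pi> (\<lambda>x. exp (A * \<bar>W x\<bar>))"
  proof (rule Bochner_Integration.integrable_bound)
    show "integrable \<pi> (\<lambda>x. exp (A * W x) + exp ((- A) * W x))"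
      using A(1) by (intro Bochner_Integration.integrable_add int) auto
    have "exp (A * \<bar>W x\<bar>) \<le> exp (A * W x) + exp ((- A) * W x)" for x
      by (cases "W x \<ge> 0") (auto simp: abs_if)
    then show "AE x in \<pi>. norm (exp (A * \<bar>W x\<bar>)) \<le> norm (exp (A * W x) + exp ((- A) * W x))"
      by (intro AE_I2) (auto intro: order_trans[OF _ abs_ge_self])
  qed measurable
  then show ?thesis using A(1) by blast
qed

lemma AE_window_law_seq_prob:
  assumes "prob_space \<pi>" and [measurable]: "W \<in> borel_measurable \<pi>"
    and "finite_exp_moments (seq_prob \<pi>) (\<lambda>\<omega>. W (\<omega> 0))"
  shows "integrable \<pi> W"
    and "AE \<omega> in seq_prob \<pi>. window_law (\<lambda>n. W (\<omega> n)) (\<integral>\<omega>'. W (\<omega>' 0) \<partial>seq_prob \<pi>)"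
proof -
  obtain A where A: "A > 0" "integrable \<pi> (\<lambda>x. exp (A * \<bar>W x\<bar>))"
    using finite_exp_moments_coordinate[OF assms] by blast
  show "integrable \<pi> W" using AE_window_law(1)[OF assms(1,2) A] .
  show "AE \<omega> in seq_prob \<pi>. window_law (\<lambda>n. W (\<omega> n)) (\<integral>\<omega>'. W (\<omega>' 0) \<partial>seq_prob \<pi>)"
    unfolding integral_coordinate[OF assms(1,2)]
    unfolding seq_prob_def by (rule AE_window_law(2)[OF assms(1,2) A])
qed

theorem theorem2:
  fixes I0 :: "(real ^ 'n) set"
    and \<tau> :: real
    and \<rho> :: "nat \<Rightarrow> real"
    and \<pi> :: "step measure"
    and J :: "(nat \<Rightarrow> step) \<Rightarrow> nat list \<Rightarrow> (real ^ 'n) set"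
    and \<mu> :: "(nat \<Rightarrow> step) \<Rightarrow> (real ^ 'n) measure"
  assumes "compact I0" and "diameter I0 = 1" and "interior I0 \<noteq> {}"
    and "0 < \<tau>" and "\<tau> < 1"
    and "\<And>t. 1 \<le> t \<Longrightarrow> 0 < \<rho> t \<and> \<rho> t \<le> 1/2"
    and "\<And>t r. 1 \<le> t \<Longrightarrow> 0 < r \<Longrightarrow> r \<le> \<rho> t \<Longrightarrow> \<exists>K. separated_similarities \<tau> t r I0 K"
    and "borel_prob_on_Omega0 \<rho> \<pi>"
    and "\<And>\<omega>. (\<And>n. \<omega> n \<in> Omega0 \<rho>) \<Longrightarrow> moran_family \<tau> I0 \<omega> (J \<omega>)"
    and "\<And>\<omega>. (\<And>n. \<omega> n \<in> Omega0 \<rho>) \<Longrightarrow> is_moran_measure \<omega> (J \<omega>) (\<mu> \<omega>)"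
    and "finite_exp_moments (seq_prob \<pi>) (\<lambda>\<omega>. Z_val (\<omega> 0))"
  shows "\<exists>\<Gamma>\<in>sets (seq_prob \<pi>). measure (seq_prob \<pi>) \<Gamma> = 1 \<and>
    (finite_exp_moments (seq_prob \<pi>) (\<lambda>\<omega>. X_val (\<omega> 0)) \<longrightarrow>
      (\<forall>\<Phi>. dimension_function \<Phi> \<and> large \<Phi> \<longrightarrow> (\<forall>\<omega>\<in>\<Gamma>.
         lower_Phi_dim \<Phi> (\<mu> \<omega>) =
           ereal ((\<integral>\<omega>'. X_val (\<omega>' 0) \<partial>seq_prob \<pi>) / (\<integral>\<omega>'. Z_val (\<omega>' 0) \<partial>seq_prob \<pi>))))) \<and>
    (finite_exp_moments (seq_prob \<pi>) (\<lambda>\<omega>. Y_val (\<omega> 0)) \<longrightarrow>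
      (\<forall>\<Phi>. dimension_function \<Phi> \<and> large \<Phi> \<longrightarrow> (\<forall>\<omega>\<in>\<Gamma>.
         upper_Phi_dim \<Phi> (\<mu> \<omega>) =
           ereal ((\<integral>\<omega>'. Y_val (\<omega>' 0) \<partial>seq_prob \<pi>) / (\<integral>\<omega>'. Z_val (\<omega>' 0) \<partial>seq_prob \<pi>)))))"
proof -
  let ?P = "seq_prob \<pi>"
  let ?fem = "\<lambda>W. finite_exp_moments ?P (\<lambda>\<omega>. W (\<omega> 0))"
  let ?E = "\<lambda>W. \<integral>\<omega>'. W (\<omega>' 0) \<partial>?P"
  let ?wl = "\<lambda>W \<omega>. window_law (\<lambda>n. W (\<omega> n)) (?E W)"
  have \<pi>: "prob_space \<pi>" and sets_\<pi>: "sets \<pi> = sets (restrict_space borel (Omega0 \<rho>))"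
    using assms(8) by (auto simp: borel_prob_on_Omega0_def)
  interpret prob_space \<pi> by (rule \<pi>)
  interpret P: prob_space ?P unfolding seq_prob_def using \<pi> by (intro prob_space_PiM)
  have space_\<pi>: "space \<pi> = Omega0 \<rho>"
    using sets_eq_imp_space_eq[OF sets_\<pi>] by (simp add: space_restrict_space)
  have meas: "X_val \<in> borel_measurable \<pi>" "Y_val \<in> borel_measurable \<pi>" "Z_val \<in> borel_measurable \<pi>"
    unfolding measurable_cong_sets[OF sets_\<pi> refl]
    by (intro measurable_restrict_space1 measurable_step_values)+
  \<comment> \<open>The moment conditions do not depend on \<open>\<omega>\<close>. Kept as premises
    inside the event, they allow one \<open>\<Gamma>\<close> for both claims.\<close>
  have "AE \<omega> in ?P. (?fem X_val \<longrightarrow> ?wl X_val \<omega>) \<and> (?fem Y_val \<longrightarrow> ?wl Y_val \<omega>) \<and> ?wl Z_val \<omega>"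
    using AE_window_law_seq_prob(2)[OF \<pi> meas(1)] AE_window_law_seq_prob(2)[OF \<pi> meas(2)]
      AE_window_law_seq_prob(2)[OF \<pi> meas(3) assms(11)]
    by auto
  then obtain \<Gamma> where \<Gamma>: "\<Gamma> \<in> sets ?P" "measure ?P \<Gamma> = 1"
    "\<And>\<omega>. \<omega> \<in> \<Gamma> \<Longrightarrow> \<omega> \<in> space ?P \<and> (?fem X_val \<longrightarrow> ?wl X_val \<omega>) \<and> (?fem Y_val \<longrightarrow> ?wl Y_val \<omega>) \<and> ?wl Z_val \<omega>"
    by (rule P.AE_E_prob) blast
  \<comment> \<open>Ratios are at most \<open>1/2\<close>, so \<open>Z_val\<close> is at least
    \<open>ln 2\<close> everywhere.\<close>
  have z: "0 < ?E Z_val"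
  proof -
    have eq: "?E Z_val = (\<integral>x. Z_val x \<partial>\<pi>)" by (intro integral_coordinate \<pi> meas)
    have "ln 2 \<le> Z_val x" if "x \<in> Omega0 \<rho>" for x
    proof -
      have "0 < ratio x" "ratio x \<le> 1/2"
        using that assms(6)[of "num_children x"] by (auto simp: Omega0_def)
      then have "ln (ratio x) \<le> ln (1/2)" by (subst ln_le_cancel_iff) auto
      then show ?thesis by (simp add: Z_val_def ln_div)
    qed
    then have "ln 2 \<le> (\<integral>x. Z_val x \<partial>\<pi>)"
      using AE_window_law_seq_prob(1)[OF \<pi> meas(3) assms(11)]
      by (intro integral_ge_const AE_I2) (auto simp: space_\<pi>)
    moreover have "0 < ln (2 :: real)" by simp
    ultimately show ?thesis unfolding eq by linarith
  qed
  have tree: "moran_tree \<tau> I0 \<rho> \<omega> (J \<omega>) (\<mu> \<omega>)" if "\<omega> \<in> \<Gamma>" for \<omega>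
  proof -
    \<comment> \<open>\<open>\<Gamma>\<close> lies in the space of the product measure, so every
      coordinate, not just almost every one, is a point of \<open>Omega0 \<rho>\<close>.\<close>
    have "\<omega> n \<in> Omega0 \<rho>" for n
      using \<Gamma>(3)[OF that] unfolding seq_prob_def by (auto simp: space_PiM space_\<pi> PiE_iff)
    then show ?thesis
      using assms(1,2,4-6,9,10) by unfold_locales auto
  qed
  show ?thesis
    using \<Gamma>(3) z
    by (intro bexI[OF _ \<Gamma>(1)] conjI \<Gamma>(2) impI allI ballI)
      (auto intro!: moran_tree.lower_Phi_dim_eq[OF tree] moran_tree.upper_Phi_dim_eq[OF tree])
qed

end
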